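(* Let $\mathbf U\subset\mathbb R^2$ be the set of couples $(x,q)$ with $q>1$ such that $x$ has exactly one expansion in base $q$ (i.e. exactly one sequence $(c_i)_{i\ge1}$ of integers with $0\le c_i<q$ for all $i$ and $x=\sum_{i=1}^\infty c_iq^{-i}$). Let $\overline{\mathbf U}$ denote its closure in $\mathbb R^2$. Then: (i) $\mathbf U$ is not closed, and $\overline{\mathbf U}$ is a Cantor set, i.e. a nonempty closed set having neither interior points nor isolated points; (ii) both $\mathbf U$ and $\overline{\mathbf U}$ have two-dimensional Lebesgue measure zero; (iii) both $\mathbf U$ and $\overline{\mathbf U}$ have Hausdorff dimension $2$.
   Context: For $q>1$, an expansion of $x$ in base $q$ is a sequence $(c_i)_{i\ge1}$ of integers with $0\le c_i<q$ for all $i$ and $x=\sum_{i\ge1}c_iq^{-i}$. The closure is taken in $\mathbb R^2$ with its usual topology. *)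

theory Defs
  imports "HOL-Analysis.Analysis"
begin

text \<open>An expansion of x in base q: a sequence of integers c_1, c_2, ... with 0 <= c_i < q
  and x = sum c_i q^(-i). We index from 0: c n stands for c_(n+1).\<close>
definition is_expansion :: "real \<Rightarrow> real \<Rightarrow> (nat \<Rightarrow> int) \<Rightarrow> bool" where
  "is_expansion q x c \<longleftrightarrow>
     (\<forall>n. 0 \<le> c n \<and> real_of_int (c n) < q) \<and>
     (\<lambda>n. real_of_int (c n) / q ^ Suc n) sums x"

definition univoque_set :: "(real \<times> real) set" where
  "univoque_set = {(x, q). q > 1 \<and> (\<exists>!c. is_expansion q x c)}"

definition hdiam_pow :: "real \<Rightarrow> 'a::metric_space set \<Rightarrow> ennreal" where
  "hdiam_pow s C = (if C = {} then 0 else if s = 0 then 1 else ennreal (diameter C powr s))"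

definition hausdorff_approx :: "real \<Rightarrow> real \<Rightarrow> 'a::metric_space set \<Rightarrow> ennreal" where
  "hausdorff_approx s \<delta> A =
     (INF C \<in> {C :: nat \<Rightarrow> 'a set. A \<subseteq> \<Union>(range C) \<and> (\<forall>n. bounded (C n) \<and> diameter (C n) \<le> \<delta>)}.
        (\<Sum>n. hdiam_pow s (C n)))"

definition hausdorff_measure :: "real \<Rightarrow> 'a::metric_space set \<Rightarrow> ennreal" where
  "hausdorff_measure s A = (SUP \<delta> \<in> {0<..}. hausdorff_approx s \<delta> A)"

definition hausdorff_dim :: "'a::metric_space set \<Rightarrow> ereal" where
  "hausdorff_dim A = Inf {ereal s | s. 0 \<le> s \<and> hausdorff_measure s A = 0}"

end

theory Submission
  imports Defs
begin

text \<open>An expansion \<open>c\<close> in base \<open>q\<close> with largest digit \<open>M\<close> is unique iff each tail value \<open>t\<close> following a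
  digit below \<open>M\<close> satisfies \<open>t < 1\<close> and each tail following a positive digit satisfies
  \<open>M/(q-1) - t < 1\<close>. Both quantities decrease when \<open>q\<close> grows while \<open>M\<close> stays fixed, so for non-integer
  \<open>q\<close> a unique expansion stays unique in slightly larger bases; for integer \<open>q\<close> all irrationals in
  \<open>(0, 1)\<close> are univoque. Hence there are no isolated points.

  For non-integer \<open>q\<close> the slice \<open>X\<close> of the closure is a compact set mapped into itself by
  \<open>x \<mapsto> q x - k\<close>, where points with different digits \<open>k\<close> lie a definite distance apart. So \<open>X\<close> contains
  no interval and, by self-similarity, is uniformly porous, hence null; Fubini's theorem finishes.

  For the dimension, all digit sequences over \<open>{1..M-1}\<close> are unique expansions. They are parametrised,
  together with \<open>q\<close>, by a product of two intervals, and a plane set of diameter \<open>d\<close> has a preimage of area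
  \<open>O(d powr (1 + t))\<close> with \<open>t\<close> close to 1 for large \<open>M\<close> (mass distribution principle).\<close>

section \<open>Values of digit sequences and unique expansions\<close>

text \<open>The base and the digits are separate arguments, so that one digit sequence can be
  evaluated in varying bases.\<close>

definition base_value :: "real \<Rightarrow> (nat \<Rightarrow> int) \<Rightarrow> real" where
  "base_value q c = (\<Sum>n. real_of_int (c n) / q ^ Suc n)"

lemma sums_const_over_powers:
  fixes q :: real
  assumes "q > 1"
  shows "(\<lambda>n. b / q ^ Suc n) sums (b / (q - 1))"
proof -
  have "(\<lambda>n. (b / q) * (1 / q) ^ n) sums ((b / q) * (1 / (1 - 1 / q)))"
    by (intro sums_mult geometric_sums) (use assms in auto)
  moreover have "(b / q) * (1 / (1 - 1 / q)) = b / (q - 1)"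
    using assms by (simp add: field_simps)
  moreover have "(\<lambda>n. (b / q) * (1 / q) ^ n) = (\<lambda>n. b / q ^ Suc n)"
    by (simp add: power_divide fun_eq_iff)
  ultimately show ?thesis by metis
qed

lemma summable_bounded_digits:
  assumes "q > 1" "\<forall>n. a \<le> c n \<and> c n \<le> b"
  shows "summable (\<lambda>n. real_of_int (c n) / q ^ Suc n)"
proof (rule summable_comparison_test')
  show "summable (\<lambda>n. real_of_int (max \<bar>a\<bar> \<bar>b\<bar>) / q ^ Suc n)"
    using sums_const_over_powers[OF assms(1)] sums_summable by blast
  show "norm (real_of_int (c n) / q ^ Suc n) \<le> real_of_int (max \<bar>a\<bar> \<bar>b\<bar>) / q ^ Suc n"
    if "n \<ge> 0" for n
  proof -
    have "\<bar>c n\<bar> \<le> max \<bar>a\<bar> \<bar>b\<bar>" using assms(2)[rule_format, of n] by auto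
    then have "\<bar>real_of_int (c n)\<bar> \<le> real_of_int (max \<bar>a\<bar> \<bar>b\<bar>)" by linarith
    then show ?thesis using assms(1)
      by (simp add: abs_mult power_abs divide_right_mono)
  qed
qed

lemma base_value_ge:
  assumes "q > 1" "\<forall>n. a \<le> c n \<and> c n \<le> b"
  shows "real_of_int a / (q - 1) \<le> base_value q c"
proof -
  have "real_of_int a / q ^ Suc n \<le> real_of_int (c n) / q ^ Suc n" for n
    using assms by (intro divide_right_mono) auto
  then show ?thesis unfolding base_value_def
    by (rule sums_le[OF _ sums_const_over_powers[OF assms(1)]
          summable_sums[OF summable_bounded_digits[of q a c b, OF assms]]])
qed

lemma base_value_le:
  assumes "q > 1" "\<forall>n. a \<le> c n \<and> c n \<le> b"
  shows "base_value q c \<le> real_of_int b / (q - 1)"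
proof -
  have "real_of_int (c n) / q ^ Suc n \<le> real_of_int b / q ^ Suc n" for n
    using assms by (intro divide_right_mono) auto
  then show ?thesis unfolding base_value_def
    by (rule sums_le[OF _ summable_sums[OF summable_bounded_digits[of q a c b, OF assms]]
          sums_const_over_powers[OF assms(1)]])
qed

lemma base_value_Suc:
  assumes "q > 1" "\<forall>n. a \<le> c n \<and> c n \<le> b"
  shows "q * base_value q c = real_of_int (c 0) + base_value q (\<lambda>i. c (Suc i))"
proof -
  have "base_value q c = (\<Sum>n. real_of_int (c (Suc n)) / q ^ Suc (Suc n)) + real_of_int (c 0) / q"
    unfolding base_value_def using suminf_split_head[OF summable_bounded_digits[of q a c b, OF assms]] by simp
  moreover have "(\<Sum>n. real_of_int (c (Suc n)) / q ^ Suc (Suc n))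
      = base_value q (\<lambda>i. c (Suc i)) / q"
    unfolding base_value_def
    using suminf_divide[OF summable_bounded_digits[OF assms(1), of a "\<lambda>n. c (Suc n)" b], of q] assms(2)
    by (simp add: mult.commute)
  ultimately show ?thesis using assms(1) by (simp add: field_simps)
qed

lemma base_value_tail:
  assumes "q > 1" "\<forall>n. a \<le> c n \<and> c n \<le> b"
  shows "q * base_value q (\<lambda>i. c (n + i)) = real_of_int (c n) + base_value q (\<lambda>i. c (Suc n + i))"
  using base_value_Suc[OF assms(1), of a "\<lambda>i. c (n + i)" b] assms(2) by simp

text \<open>Removing a common leading digit multiplies the difference of two values by
  \<open>q\<close>. Used to move a first disagreement to the front.\<close>

lemma base_value_diff_tails:
  assumes "q > 1" "\<forall>n. a \<le> c n \<and> c n \<le> b" "\<forall>n. a \<le> e n \<and> e n \<le> b"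
    and "\<And>i. i < n \<Longrightarrow> c i = e i"
  shows "base_value q (\<lambda>i. c (n + i)) - base_value q (\<lambda>i. e (n + i))
    = q ^ n * (base_value q c - base_value q e)"
  using assms(4)
proof (induction n)
  case (Suc n)
  have "q * base_value q (\<lambda>i. c (n + i)) - q * base_value q (\<lambda>i. e (n + i))
      = base_value q (\<lambda>i. c (Suc n + i)) - base_value q (\<lambda>i. e (Suc n + i))"
    using base_value_tail[OF assms(1), of a c b n] base_value_tail[OF assms(1), of a e b n]
      assms(2,3) Suc.prems by auto
  then have "base_value q (\<lambda>i. c (Suc n + i)) - base_value q (\<lambda>i. e (Suc n + i))
      = q * (q ^ n * (base_value q c - base_value q e))"
    using Suc by (simp flip: right_diff_distrib)
  then show ?case by simp
qed simp

lemma base_value_antimono: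
  assumes "1 < q" "q \<le> q'" "\<forall>n. 0 \<le> c n \<and> c n \<le> b"
  shows "base_value q' c \<le> base_value q c"
  unfolding base_value_def
proof (rule suminf_le)
  show "real_of_int (c n) / q' ^ Suc n \<le> real_of_int (c n) / q ^ Suc n" for n
    using assms by (intro divide_left_mono power_mono mult_pos_pos) auto
qed (use assms summable_bounded_digits[of _ 0 c b] in auto)

lemma base_value_reflect:
  assumes "q > 1" "\<forall>n. a \<le> c n \<and> c n \<le> b"
  shows "base_value q (\<lambda>n. m - c n) = real_of_int m / (q - 1) - base_value q c"
proof -
  have "(\<lambda>n. real_of_int m / q ^ Suc n - real_of_int (c n) / q ^ Suc n)
      sums (real_of_int m / (q - 1) - base_value q c)"
    unfolding base_value_def
    by (intro sums_diff sums_const_over_powers[OF assms(1)] summable_sums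
        summable_bounded_digits[of q a c b, OF assms])
  then have "(\<lambda>n. real_of_int (m - c n) / q ^ Suc n) sums (real_of_int m / (q - 1) - base_value q c)"
    by (simp add: diff_divide_distrib)
  then show ?thesis unfolding base_value_def[of q "\<lambda>n. m - c n"] by (rule sums_unique[symmetric])
qed

section \<open>Existence of expansions and the criterion for uniqueness\<close>

text \<open>Digits are strictly below \<open>q\<close>, so an integer base has largest digit
  \<open>q - 1\<close>; the floor of \<open>q\<close> would be wrong there.\<close>

abbreviation max_digit :: "real \<Rightarrow> int" where
  "max_digit q \<equiv> \<lceil>q\<rceil> - 1"

lemma is_expansion_iff:
  assumes "q > 1"
  shows "is_expansion q x c \<longleftrightarrow> (\<forall>n. 0 \<le> c n \<and> c n \<le> max_digit q) \<and> base_value q c = x"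
proof -
  have *: "real_of_int k < q \<longleftrightarrow> k \<le> max_digit q" for k by linarith
  show ?thesis
    using summable_bounded_digits[OF assms, of 0 c "max_digit q"]
    unfolding is_expansion_def * base_value_def by (auto simp: sums_iff)
qed

lemma max_digit_ge: "q > 1 \<Longrightarrow> max_digit q \<ge> 1" "real_of_int (max_digit q) \<ge> q - 1"
  "real_of_int (max_digit q) < q"
  by linarith+

text \<open>The partial sums telescope to \<open>r 0 - r n / q ^ n\<close>, and a bounded remainder
  disappears after division by \<open>q ^ n\<close>.\<close>

lemma sums_of_bounded_remainders:
  fixes q :: real
  assumes "q > 1" "\<And>n. r (Suc n) = q * r n - real_of_int (d n)" "\<And>n. \<bar>r n\<bar> \<le> B"
  shows "(\<lambda>n. real_of_int (d n) / q ^ Suc n) sums r 0"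
proof -
  have *: "(\<Sum>i<n. real_of_int (d i) / q ^ Suc i) = r 0 - r n / q ^ n" for n
  proof (induction n)
    case (Suc n)
    have "r n / q ^ n = q * r n / q ^ Suc n" using assms(1) by simp
    then show ?case using Suc assms(2)[of n] by (simp add: diff_divide_distrib)
  qed simp
  have "(\<lambda>n. B * (1 / q) ^ n) \<longlonglongrightarrow> B * 0"
    by (intro tendsto_mult tendsto_const LIMSEQ_power_zero) (use assms(1) in auto)
  then have lim: "(\<lambda>n. B * (1 / q) ^ n) \<longlonglongrightarrow> 0" by simp
  have "(\<lambda>n. r n / q ^ n) \<longlonglongrightarrow> 0"
    by (rule Lim_null_comparison[OF always_eventually lim])
       (use assms in \<open>auto simp: power_divide abs_mult power_abs intro!: divide_right_mono\<close>)
  then have "(\<lambda>n. r 0 - r n / q ^ n) \<longlonglongrightarrow> r 0 - 0" by (intro tendsto_intros)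
  then show ?thesis unfolding sums_def * by simp
qed

text \<open>Greedy algorithm: always taking the largest possible digit keeps the remainder in
  \<open>{0..L}\<close>, where \<open>L\<close> is the fixed point of
  \<open>y \<mapsto> q y - M\<close>.\<close>

lemma expansion_exists:
  assumes q: "q > 1" and "0 \<le> x" "x \<le> real_of_int (max_digit q) / (q - 1)"
  shows "\<exists>c. is_expansion q x c"
proof -
  define M where "M = max_digit q"
  define L where "L = real_of_int M / (q - 1)"
  \<comment> \<open>The cap at \<open>M\<close> matters when \<open>q * y\<close> reaches
    \<open>M + 1\<close>; the remainder then stays below \<open>L\<close> by the fixed point
    equation.\<close>
  define d where "d y = min M \<lfloor>q * y\<rfloor>" for y
  define r where "r n = ((\<lambda>y. q * y - real_of_int (d y)) ^^ n) x" for n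
  have M: "M \<ge> 1" "real_of_int M \<ge> q - 1" "real_of_int M < q"
    using max_digit_ge[of q] q unfolding M_def by auto
  have L1: "L \<ge> 1" and qL: "q * L = real_of_int M + L"
    using M q unfolding L_def by (auto simp: field_simps)
  have step: "0 \<le> q * y - real_of_int (d y) \<and> q * y - real_of_int (d y) \<le> L"
    if y: "0 \<le> y" "y \<le> L" for y
  proof (cases "\<lfloor>q * y\<rfloor> \<le> M")
    case True
    then have "d y = \<lfloor>q * y\<rfloor>" unfolding d_def by simp
    then show ?thesis using L1 by linarith
  next
    case False
    then have dM: "d y = M" unfolding d_def by simp
    have "q * y \<le> q * L" using y q by simp
    then show ?thesis using qL dM False by linarith
  qed
  have r: "0 \<le> r n \<and> r n \<le> L" for n
    using assms step by (induction n) (auto simp: r_def L_def M_def)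
  have "(\<lambda>n. real_of_int (d (r n)) / q ^ Suc n) sums r 0"
    by (rule sums_of_bounded_remainders[where B = L]) (use q r in \<open>auto simp: r_def\<close>)
  moreover have "0 \<le> d (r n) \<and> real_of_int (d (r n)) < q" for n
  proof -
    have "0 \<le> q * r n" using r[of n] q by simp
    then show ?thesis unfolding d_def using M by (auto simp: min_def)
  qed
  moreover have "r 0 = x" by (simp add: r_def)
  ultimately show ?thesis unfolding is_expansion_def by metis
qed

text \<open>Source of second expansions: one digit is altered and the tail is replaced by an
  expansion of the number that compensates for it. It is applied with \<open>k = c n + 1\<close> and
  \<open>k = c n - 1\<close>.\<close>

lemma is_expansion_splice:
  assumes q: "q > 1" and c: "is_expansion q x c"
    and k: "0 \<le> k" "k \<le> max_digit q" "k \<noteq> c n"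
    and y: "0 \<le> y" "y \<le> real_of_int (max_digit q) / (q - 1)"
    and eq: "real_of_int k + y = real_of_int (c n) + base_value q (\<lambda>i. c (Suc n + i))"
  shows "\<exists>e. is_expansion q x e \<and> e \<noteq> c"
proof -
  obtain f where f: "is_expansion q y f" using expansion_exists[OF q y] by auto
  define e where "e i = (if i < n then c i else if i = n then k else f (i - Suc n))" for i
  let ?M = "max_digit q"
  have c': "\<forall>i. 0 \<le> c i \<and> c i \<le> ?M" "base_value q c = x"
    using c is_expansion_iff[OF q] by auto
  have f': "\<forall>i. 0 \<le> f i \<and> f i \<le> ?M" "base_value q f = y"
    using f is_expansion_iff[OF q] by auto
  have e': "\<forall>i. 0 \<le> e i \<and> e i \<le> ?M" using c' f' k unfolding e_def by auto
  have "q * base_value q (\<lambda>i. e (n + i)) = real_of_int (e n) + base_value q (\<lambda>i. e (Suc n + i))"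
    by (rule base_value_tail[OF q e'])
  also have "(\<lambda>i. e (Suc n + i)) = f" by (auto simp: e_def)
  also have "real_of_int (e n) + base_value q f = real_of_int k + y" by (simp add: e_def f')
  also have "\<dots> = q * base_value q (\<lambda>i. c (n + i))"
    using base_value_tail[OF q c'(1), of n] eq by simp
  finally have "base_value q (\<lambda>i. c (n + i)) - base_value q (\<lambda>i. e (n + i)) = 0"
    using q by simp
  moreover have "base_value q (\<lambda>i. c (n + i)) - base_value q (\<lambda>i. e (n + i))
      = q ^ n * (base_value q c - base_value q e)"
    by (rule base_value_diff_tails[OF q c'(1) e']) (simp add: e_def)
  ultimately have "base_value q e = x" using q c' by simp
  then have "is_expansion q x e" using is_expansion_iff[OF q] e' by blast
  moreover have "e n \<noteq> c n" using k by (simp add: e_def)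
  ultimately show ?thesis by metis
qed

text \<open>If a condition fails, the digit can be raised or lowered by 1, because the tail changed
  by 1 the other way still lies in \<open>{0..L}\<close>. Conversely, at the first disagreement with
  another expansion the conditions would push the tail of that expansion out of
  \<open>{0..L}\<close>.\<close>

lemma univoque_iff:
  assumes q: "q > 1" and c: "is_expansion q x c"
  shows "(x, q) \<in> univoque_set \<longleftrightarrow>
    (\<forall>n. (c n < max_digit q \<longrightarrow> base_value q (\<lambda>i. c (Suc n + i)) < 1) \<and>
         (0 < c n \<longrightarrow> real_of_int (max_digit q) / (q - 1) - base_value q (\<lambda>i. c (Suc n + i)) < 1))"
    (is "_ \<longleftrightarrow> (\<forall>n. ?C n)")
proof
  define L where "L = real_of_int (max_digit q) / (q - 1)"
  note c' = c[unfolded is_expansion_iff[OF q]]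
  have tail: "0 \<le> base_value q (\<lambda>i. c (n + i)) \<and> base_value q (\<lambda>i. c (n + i)) \<le> L" for n
    using base_value_ge[OF q, of 0 "\<lambda>i. c (n + i)" "max_digit q"]
      base_value_le[OF q, of 0 "\<lambda>i. c (n + i)" "max_digit q"] c' unfolding L_def by auto
  {
    assume "(x, q) \<in> univoque_set"
    then have uniq: "\<not> (\<exists>e. is_expansion q x e \<and> e \<noteq> c)"
      using c unfolding univoque_set_def by auto
    show "\<forall>n. ?C n"
    proof (intro allI conjI impI)
      fix n
      let ?t = "base_value q (\<lambda>i. c (Suc n + i))"
      have t: "0 \<le> ?t" "?t \<le> L" using tail[of "Suc n"] by auto
      show "?t < 1" if "c n < max_digit q"
      proof (rule ccontr)
        assume "\<not> ?t < 1"
        then show False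
          using is_expansion_splice[OF q c, of "c n + 1" n "?t - 1"] that c' t uniq
          unfolding L_def by simp
      qed
      show "real_of_int (max_digit q) / (q - 1) - ?t < 1" if "0 < c n"
      proof (rule ccontr)
        assume "\<not> real_of_int (max_digit q) / (q - 1) - ?t < 1"
        then show False
          using is_expansion_splice[OF q c, of "c n - 1" n "?t + 1"] that c' t uniq
            c'[THEN conjunct1, rule_format, of n] unfolding L_def by simp
      qed
    qed
  }
  {
    assume cond: "\<forall>n. ?C n"
    have "e = c" if e: "is_expansion q x e" for e
    proof (rule ccontr)
      assume "e \<noteq> c"
      then have ex: "\<exists>n. e n \<noteq> c n" by auto
      define n where "n = (LEAST n. e n \<noteq> c n)"
      have n: "e n \<noteq> c n" "\<And>i. i < n \<Longrightarrow> c i = e i"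
        using LeastI_ex[OF ex] not_less_Least[of _ "\<lambda>n. e n \<noteq> c n"] unfolding n_def by metis+
      note e' = e[unfolded is_expansion_iff[OF q]]
      have cb: "\<forall>i. 0 \<le> c i \<and> c i \<le> max_digit q" and eb: "\<forall>i. 0 \<le> e i \<and> e i \<le> max_digit q"
        using c' e' by auto
      have "base_value q (\<lambda>i. c (n + i)) = base_value q (\<lambda>i. e (n + i))"
        using base_value_diff_tails[OF q cb eb n(2)] c' e' by simp
      then have eq: "real_of_int (c n) + base_value q (\<lambda>i. c (Suc n + i))
          = real_of_int (e n) + base_value q (\<lambda>i. e (Suc n + i))"
        using base_value_tail[OF q cb, of n] base_value_tail[OF q eb, of n] by simp
      have te: "0 \<le> base_value q (\<lambda>i. e (Suc n + i)) \<and> base_value q (\<lambda>i. e (Suc n + i)) \<le> L"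
        using base_value_ge[OF q, of 0 "\<lambda>i. e (Suc n + i)" "max_digit q"]
          base_value_le[OF q, of 0 "\<lambda>i. e (Suc n + i)" "max_digit q"] e' unfolding L_def by auto
      consider "c n + 1 \<le> e n" | "e n + 1 \<le> c n" using n(1) by linarith
      then show False
      proof cases
        case 1
        then have "c n < max_digit q" using eb[rule_format, of n] by linarith
        then have "base_value q (\<lambda>i. c (Suc n + i)) < 1" using cond by blast
        moreover have "real_of_int (c n) + 1 \<le> real_of_int (e n)" using 1 by linarith
        ultimately show False using eq te by linarith
      next
        case 2
        then have "0 < c n" using eb[rule_format, of n] by linarith
        then have "L - base_value q (\<lambda>i. c (Suc n + i)) < 1" using cond unfolding L_def by blast
        moreover have "real_of_int (e n) + 1 \<le> real_of_int (c n)" using 2 by linarith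
        ultimately show False using eq te by linarith
      qed
    qed
    then show "(x, q) \<in> univoque_set" using c q unfolding univoque_set_def by auto
  }
qed

section \<open>Limit points of the univoque set\<close>

text \<open>The shift by the first digit preserves univoque points. Stating this without the digit
  sequence lets it be passed to limits.\<close>

lemma univoque_digit:
  assumes "(x, q) \<in> univoque_set"
  shows "\<exists>k. 0 \<le> k \<and> k \<le> max_digit q \<and> (q * x - real_of_int k, q) \<in> univoque_set
    \<and> (k < max_digit q \<longrightarrow> q * x - real_of_int k < 1)
    \<and> (0 < k \<longrightarrow> real_of_int (max_digit q) / (q - 1) - (q * x - real_of_int k) < 1)"
proof -
  obtain c where q: "q > 1" and c: "is_expansion q x c"
    using assms unfolding univoque_set_def by auto
  note c' = c[unfolded is_expansion_iff[OF q]]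
  have v: "q * x - real_of_int (c 0) = base_value q (\<lambda>i. c (Suc i))"
    using base_value_Suc[OF q conjunct1[OF c']] c' by simp
  have e: "is_expansion q (q * x - real_of_int (c 0)) (\<lambda>i. c (Suc i))"
    unfolding is_expansion_iff[OF q] v using c' by auto
  have cond: "(c n < max_digit q \<longrightarrow> base_value q (\<lambda>i. c (Suc n + i)) < 1) \<and>
         (0 < c n \<longrightarrow> real_of_int (max_digit q) / (q - 1) - base_value q (\<lambda>i. c (Suc n + i)) < 1)" for n
    using assms univoque_iff[OF q c] by blast
  have "(q * x - real_of_int (c 0), q) \<in> univoque_set"
    unfolding univoque_iff[OF q e] using cond[of "Suc n" for n] by simp
  then show ?thesis using cond[of 0] c' v by (intro exI[of _ "c 0"]) auto
qed

lemma univoque_bounds: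
  assumes "(x, q) \<in> univoque_set"
  shows "q > 1" "0 \<le> x" "x \<le> real_of_int (max_digit q) / (q - 1)"
proof -
  obtain c where q: "q > 1" and c: "is_expansion q x c"
    using assms unfolding univoque_set_def by auto
  show "q > 1" by fact
  show "0 \<le> x" "x \<le> real_of_int (max_digit q) / (q - 1)"
    using base_value_ge[OF q, of 0 c "max_digit q"] base_value_le[OF q, of 0 c "max_digit q"] c[unfolded is_expansion_iff[OF q]]
    by auto
qed

text \<open>Equal ceilings keep the largest digit fixed, and both quantities in
  \<open>univoque_iff\<close> are values of nonnegative digit sequences, which do not increase with
  the base.\<close>

lemma univoque_base_increase:
  assumes U: "(x, q) \<in> univoque_set" and c: "is_expansion q x c"
    and q': "q \<le> q'" "\<lceil>q'\<rceil> = \<lceil>q\<rceil>"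
  shows "(base_value q' c, q') \<in> univoque_set"
proof -
  have q: "q > 1" using univoque_bounds[OF U] by simp
  let ?M = "max_digit q"
  have c': "\<forall>n. 0 \<le> c n \<and> c n \<le> ?M" using c is_expansion_iff[OF q] by auto
  have e: "is_expansion q' (base_value q' c) c"
    using is_expansion_iff[of q'] q q' c' by auto
  have "base_value q' (\<lambda>i. c (Suc n + i)) < 1" if "c n < ?M" for n
  proof -
    have 1: "\<forall>i. 0 \<le> c (Suc n + i) \<and> c (Suc n + i) \<le> ?M" using c' by blast
    have "base_value q' (\<lambda>i. c (Suc n + i)) \<le> base_value q (\<lambda>i. c (Suc n + i))"
      by (rule base_value_antimono[OF q q'(1), of _ ?M]) (use 1 in blast)
    also have "\<dots> < 1" using U that univoque_iff[OF q c] by blast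
    finally show ?thesis .
  qed
  moreover have "real_of_int ?M / (q' - 1) - base_value q' (\<lambda>i. c (Suc n + i)) < 1" if "0 < c n" for n
  proof -
    have 1: "\<forall>i. 0 \<le> c (Suc n + i) \<and> c (Suc n + i) \<le> ?M" using c' by blast
    \<comment> \<open>Reflecting the digits, \<open>k \<mapsto> ?M - k\<close>, turns the second
      quantity into a value to which antitonicity applies.\<close>
    have "real_of_int ?M / (q' - 1) - base_value q' (\<lambda>i. c (Suc n + i))
        = base_value q' (\<lambda>i. ?M - c (Suc n + i))"
      by (rule base_value_reflect[OF _ 1, symmetric]) (use q q' in auto)
    also have "\<dots> \<le> base_value q (\<lambda>i. ?M - c (Suc n + i))"
      by (rule base_value_antimono[OF q q'(1), of _ ?M]) (use 1 in \<open>force simp: algebra_simps\<close>)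
    also have "\<dots> = real_of_int ?M / (q - 1) - base_value q (\<lambda>i. c (Suc n + i))"
      by (rule base_value_reflect[OF q 1])
    also have "\<dots> < 1" using U that univoque_iff[OF q c] by blast
    finally show ?thesis .
  qed
  ultimately show ?thesis using univoque_iff[OF _ e] q q' by auto
qed

text \<open>In an integer base the values fill \<open>{0..1}\<close>, so the criterion can fail only
  at a tail equal to 0 or 1; all tails of an irrational number are irrational.\<close>

lemma univoque_integer_base:
  assumes "m \<ge> 2" "0 < x" "x < 1" "x \<notin> \<rat>"
  shows "(x, real_of_int m) \<in> univoque_set"
proof -
  let ?q = "real_of_int m"
  have q: "?q > 1" using assms by simp
  have L: "real_of_int (max_digit ?q) / (?q - 1) = 1" using assms by simp
  obtain c where c: "is_expansion ?q x c"
    using expansion_exists[OF q, of x] assms unfolding L by auto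
  have c': "\<forall>n. 0 \<le> c n \<and> c n \<le> m - 1" "base_value ?q c = x"
    using c is_expansion_iff[OF q] by auto
  have irr: "base_value ?q (\<lambda>i. c (n + i)) \<notin> \<rat>" for n
  proof (induction n)
    case (Suc n)
    have "?q * base_value ?q (\<lambda>i. c (n + i)) = of_int (c n) + base_value ?q (\<lambda>i. c (Suc n + i))"
      by (rule base_value_tail[OF q c'(1)])
    then have "base_value ?q (\<lambda>i. c (n + i)) = (of_int (c n) + base_value ?q (\<lambda>i. c (Suc n + i))) / ?q"
      using q by (simp add: field_simps)
    then show ?case using Suc by (metis Rats_add Rats_divide Rats_of_int)
  qed (use c' assms in auto)
  have "0 < base_value ?q (\<lambda>i. c (n + i)) \<and> base_value ?q (\<lambda>i. c (n + i)) < 1" for n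
  proof -
    have "0 \<le> base_value ?q (\<lambda>i. c (n + i)) \<and> base_value ?q (\<lambda>i. c (n + i)) \<le> 1"
      using base_value_ge[OF q, of 0 "\<lambda>i. c (n + i)" "m - 1"]
        base_value_le[OF q, of 0 "\<lambda>i. c (n + i)" "m - 1"] c' L by auto
    moreover have "base_value ?q (\<lambda>i. c (n + i)) \<noteq> 0" "base_value ?q (\<lambda>i. c (n + i)) \<noteq> 1"
      using irr[of n] by (metis Rats_0, metis Rats_1)
    ultimately show ?thesis by linarith
  qed
  from this[of "Suc n" for n] show ?thesis unfolding univoque_iff[OF q c] L by auto
qed

lemma irrational_between:
  fixes a b :: real
  assumes "a < b"
  shows "\<exists>x. a < x \<and> x < b \<and> x \<notin> \<rat>"
proof -
  have "\<exists>x\<in>{a<..<b}. x \<notin> \<rat>"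
    using assms countable_rat by (intro open_minus_countable) auto
  then show ?thesis by auto
qed

text \<open>The value is a power series in \<open>1 / q\<close> with bounded coefficients, hence
  continuous inside the unit disc.\<close>

lemma base_value_tendsto:
  assumes q: "q > 1" and c: "\<forall>n. a \<le> c n \<and> c n \<le> b"
  shows "((\<lambda>q'. base_value q' c) \<longlongrightarrow> base_value q c) (at q)"
proof -
  define P where "P y = (\<Sum>n. real_of_int (c n) * y ^ n)" for y :: real
  have series: "summable (\<lambda>n. real_of_int (c n) * (1 / r) ^ n)" if "r > 1" for r
  proof -
    have "summable (\<lambda>n. r * (real_of_int (c n) / r ^ Suc n))"
      using summable_bounded_digits[OF that c] by (rule summable_mult)
    then show ?thesis using that by (simp add: power_one_over)
  qed
  have val: "(1 / r) * P (1 / r) = base_value r c" if "r > 1" for r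
    using suminf_mult[OF series[OF that], of "1 / r"]
    unfolding base_value_def P_def by (simp add: power_one_over)
  \<comment> \<open>Any base strictly between 1 and \<open>q\<close> works: convergence at
    \<open>1 / r\<close> puts \<open>1 / q\<close> in the interior of the disc of
    convergence.\<close>
  define r where "r = (1 + q) / 2"
  have r: "1 < r" "r < q" using q unfolding r_def by auto
  have "1 / q < 1 / r" using r by (intro divide_strict_left_mono) auto
  then have "norm (1 / q) < norm (1 / r)" using r by simp
  then have "isCont P (1 / q)" unfolding P_def by (rule isCont_powser[OF series[OF r(1)]])
  moreover have inv: "isCont (\<lambda>q'. 1 / q') q" by (rule isCont_divide) (use q in simp_all)
  ultimately have "isCont (\<lambda>q'. P (1 / q')) q" by (rule isCont_o2[rotated])
  with inv have "isCont (\<lambda>q'. (1 / q') * P (1 / q')) q" by (rule isCont_mult)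
  then have lim: "((\<lambda>q'. (1 / q') * P (1 / q')) \<longlongrightarrow> base_value q c) (at q)"
    unfolding isCont_def val[OF q] .
  have "\<forall>\<^sub>F r in at q. 1 < r"
    using q by (intro order_tendstoD(1)[OF tendsto_ident_at])
  then have "\<forall>\<^sub>F r in at q. (1 / r) * P (1 / r) = base_value r c"
    by (rule eventually_mono) (rule val)
  with lim show ?thesis by (rule Lim_transform_eventually)
qed

text \<open>For integer \<open>q\<close> the point is approached horizontally, along irrational
  \<open>x\<close>. For other \<open>q\<close> it is approached along the curve that keeps the
  digits and increases the base.\<close>

lemma univoque_islimpt:
  assumes U: "(x, q) \<in> univoque_set"
  shows "(x, q) islimpt univoque_set"
proof (cases "q \<in> \<int>")
  case True
  then obtain m where m: "q = real_of_int m" by (auto elim: Ints_cases)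
  note b = univoque_bounds[OF U]
  have m2: "m \<ge> 2" using b(1) m by simp
  have x: "0 \<le> x" "x \<le> 1" using b m m2 by auto
  show ?thesis unfolding islimpt_approachable
  proof (intro allI impI)
    fix e :: real assume "e > 0"
    \<comment> \<open>Since \<open>x\<close> may be an endpoint of \<open>{0..1}\<close>, a
      one-sided interval is used: to the right of \<open>x\<close>, or to the left if
      \<open>x = 1\<close>.\<close>
    have "\<exists>a b. 0 \<le> a \<and> b \<le> 1 \<and> a < b \<and> (\<forall>z. a < z \<and> z < b \<longrightarrow> z \<noteq> x \<and> \<bar>z - x\<bar> < e)"
    proof (cases "x < 1")
      case True
      then show ?thesis using x \<open>e > 0\<close>
        by (intro exI[of _ x] exI[of _ "min 1 (x + e)"]) auto
    next
      case False
      then show ?thesis using x \<open>e > 0\<close>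
        by (intro exI[of _ "max 0 (x - e)"] exI[of _ x]) auto
    qed
    then obtain a b where ab: "0 \<le> a" "b \<le> 1" "a < b" "\<And>z. a < z \<Longrightarrow> z < b \<Longrightarrow> z \<noteq> x \<and> \<bar>z - x\<bar> < e"
      by blast
    obtain z where z: "a < z" "z < b" "z \<notin> \<rat>" using irrational_between[OF ab(3)] by blast
    have "(z, q) \<in> univoque_set" unfolding m using z ab m2 by (intro univoque_integer_base) auto
    moreover have "(z, q) \<noteq> (x, q)" "dist (z, q) (x, q) < e"
      using ab(4)[OF z(1,2)] by (auto simp: dist_Pair_Pair dist_real_def)
    ultimately show "\<exists>x'\<in>univoque_set. x' \<noteq> (x, q) \<and> dist x' (x, q) < e" by blast
  qed
next
  case False
  have q: "q > 1" using univoque_bounds[OF U] by simp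
  obtain c where c: "is_expansion q x c" using U unfolding univoque_set_def by auto
  note c' = c[unfolded is_expansion_iff[OF q]]
  have "q < real_of_int \<lceil>q\<rceil>"
    using False by (metis Ints_of_int le_of_int_ceiling less_eq_real_def)
  then have ev: "\<forall>\<^sub>F q' in at_right q. q' \<in> {q<..<real_of_int \<lceil>q\<rceil>}"
    by (rule eventually_at_right_real)
  have near: "(base_value q' c, q') \<in> univoque_set - {(x, q)}" if "q' \<in> {q<..<real_of_int \<lceil>q\<rceil>}" for q'
  proof -
    have "q < q'" "\<lceil>q'\<rceil> = \<lceil>q\<rceil>" using that by (simp, intro ceiling_unique) (auto, linarith)
    then show ?thesis using univoque_base_increase[OF U c, of q'] by simp
  qed
  have evU: "\<forall>\<^sub>F q' in at_right q. (base_value q' c, q') \<in> univoque_set - {(x, q)}"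
    by (rule eventually_mono[OF ev near])
  have "((\<lambda>q'. base_value q' c) \<longlongrightarrow> base_value q c) (at_right q)"
    by (rule tendsto_within_subset[OF base_value_tendsto[OF q conjunct1[OF c']]]) simp
  then have lim: "((\<lambda>q'. (base_value q' c, q')) \<longlongrightarrow> (x, q)) (at_right q)"
    unfolding conjunct2[OF c'] by (intro tendsto_Pair tendsto_ident_at)
  show ?thesis unfolding islimpt_approachable
  proof (intro allI impI)
    fix e :: real assume "e > 0"
    then have "\<forall>\<^sub>F q' in at_right q. dist (base_value q' c, q') (x, q) < e"
      by (rule tendstoD[OF lim])
    with evU have "\<forall>\<^sub>F q' in at_right q. (base_value q' c, q') \<in> univoque_set - {(x, q)}
      \<and> dist (base_value q' c, q') (x, q) < e" by eventually_elim simp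
    then have "\<exists>q'. (base_value q' c, q') \<in> univoque_set - {(x, q)}
      \<and> dist (base_value q' c, q') (x, q) < e"
      by (rule eventually_happens'[rotated]) simp
    then show "\<exists>x'\<in>univoque_set. x' \<noteq> (x, q) \<and> dist x' (x, q) < e" by blast
  qed
qed

text \<open>The point \<open>(1/2, 2)\<close> is a limit of irrational points in base 2, but 1/2 has
  the two binary expansions 1000... and 0111... .\<close>

lemma univoque_not_closed: "\<not> closed univoque_set"
proof
  assume cl: "closed univoque_set"
  have "(1 / 2, 2) islimpt univoque_set" unfolding islimpt_approachable
  proof (intro allI impI)
    fix e :: real assume "e > 0"
    then have "(1/2::real) < 1/2 + min (1/2) e" by simp
    then obtain z where z: "1 / 2 < z" "z < 1 / 2 + min (1/2) e" "z \<notin> \<rat>"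
      using irrational_between by blast
    then have "(z, 2) \<in> univoque_set" using univoque_integer_base[of 2 z] by auto
    moreover have "(z, 2) \<noteq> (1/2, 2::real)" "dist (z, 2::real) (1/2, 2) < e"
      using z by (auto simp: dist_Pair_Pair dist_real_def)
    ultimately show "\<exists>x'\<in>univoque_set. x' \<noteq> (1/2, 2) \<and> dist x' (1/2, 2) < e" by blast
  qed
  then have "(1 / 2, 2) \<in> univoque_set" using cl closed_limpt by blast
  \<comment> \<open>Digit 0 leaves the tail 1 and digit 1 leaves the tail 0; each violates its
    strict inequality.\<close>
  then obtain k where k: "0 \<le> k" "k \<le> 1" "k < 1 \<longrightarrow> 1 - real_of_int k < 1"
      "0 < k \<longrightarrow> 1 - (1 - real_of_int k) < 1"
    using univoque_digit[of "1/2" 2] by auto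
  then show False by (cases "k = 0") auto
qed

section \<open>Invariant sets of expanding maps\<close>

text \<open>The image of an interval in \<open>X\<close> under \<open>T\<close> is again an interval
  in \<open>X\<close>, longer by the factor \<open>q\<close>; iterating contradicts
  boundedness.\<close>

lemma expanding_invariant_no_interval:
  fixes X :: "real set" and T :: "real \<Rightarrow> real"
  assumes X: "bounded X" and q: "q > 1" and inv: "\<And>x. x \<in> X \<Longrightarrow> T x \<in> X" and g: "g > 0"
    and aff: "\<And>x y. x \<in> X \<Longrightarrow> y \<in> X \<Longrightarrow> \<bar>x - y\<bar> < g \<Longrightarrow> T x - T y = q * (x - y)"
    and ab: "a < b"
  shows "\<not> {a..b} \<subseteq> X"
proof
  assume sub: "{a..b} \<subseteq> X"
  have step: "\<exists>a' b'. {a'..b'} \<subseteq> X \<and> b' - a' = q * (b - a)" if sub: "{a..b} \<subseteq> X" and "a < b" for a b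
  proof -
    \<comment> \<open>The hypothesis is local: \<open>T y - q * y\<close> is constant at distances
      below \<open>g\<close>. Zero derivative makes it constant on the whole interval.\<close>
    have "\<exists>k. \<forall>y\<in>{a..b}. T y - q * y = k"
    proof (rule has_field_derivative_zero_constant)
      fix y assume y: "y \<in> {a..b}"
      show "((\<lambda>y. T y - q * y) has_field_derivative 0) (at y within {a..b})"
      proof (rule has_field_derivative_transform_within[OF DERIV_const g y])
        fix z assume "z \<in> {a..b}" "dist z y < g"
        then have "T z - T y = q * (z - y)"
          using aff[OF subsetD[OF sub] subsetD[OF sub]] y by (simp add: dist_real_def)
        then show "T y - q * y = T z - q * z" by (simp add: algebra_simps)
      qed
    qed simp
    then obtain k where k: "\<And>y. y \<in> {a..b} \<Longrightarrow> T y = k + q * y" by (force simp: algebra_simps)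
    have "z \<in> X" if z: "z \<in> {k + q * a..k + q * b}" for z
    proof -
      have 1: "(z - k) / q \<in> {a..b}" using z q by (auto simp: field_simps)
      have "z = T ((z - k) / q)" using k[OF 1] q by simp
      then show ?thesis using inv sub 1 by (metis subsetD)
    qed
    then show ?thesis by (intro exI[of _ "k + q * a"] exI[of _ "k + q * b"]) (auto simp: algebra_simps)
  qed
  have ex: "\<exists>a' b'. {a'..b'} \<subseteq> X \<and> b' - a' = q ^ n * (b - a)" for n
  proof (induction n)
    case 0
    show ?case using sub by (intro exI[of _ a] exI[of _ b]) simp
  next
    case (Suc n)
    then obtain a' b' where *: "{a'..b'} \<subseteq> X" "b' - a' = q ^ n * (b - a)" by blast
    have "0 < q ^ n * (b - a)" using q ab by simp
    then have "a' < b'" using * by linarith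
    from step[OF *(1) this] show ?case using * by (auto simp: mult.assoc)
  qed
  obtain B where B: "\<And>x. x \<in> X \<Longrightarrow> \<bar>x\<bar> \<le> B" using X by (auto simp: bounded_iff)
  obtain n where n: "2 * B / (b - a) < q ^ n" using real_arch_pow[OF q] by blast
  obtain a' b' where *: "{a'..b'} \<subseteq> X" "b' - a' = q ^ n * (b - a)" using ex by blast
  have "0 < q ^ n * (b - a)" using q ab by simp
  then have "a' \<in> X" "b' \<in> X" using * by auto
  then have "b' - a' \<le> 2 * B" using B[of a'] B[of b'] by linarith
  then show False using n ab *(2) by (simp add: field_simps)
qed

section \<open>From porosity to measure zero\<close>

lemma measure_scaling_preimage:
  fixes B :: "real set"
  assumes "B \<in> sets borel" "q > 0"
  shows "measure lborel B = q * measure lborel ((\<lambda>y. t + q * y) -` B)"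
proof -
  have m: "(\<lambda>y. t + q * y) -` B \<in> sets borel"
    using measurable_sets[of "\<lambda>y. t + q * y" borel borel B] assms(1) by simp
  have "emeasure lborel B = (\<integral>\<^sup>+y. indicator B y \<partial>lborel)" using assms(1) by simp
  also have "\<dots> = ennreal \<bar>q\<bar> * (\<integral>\<^sup>+y. indicator B (t + q * y) \<partial>lborel)"
    by (rule nn_integral_real_affine) (use assms in auto)
  also have "(\<integral>\<^sup>+y. indicator B (t + q * y) \<partial>lborel)
      = (\<integral>\<^sup>+y. indicator ((\<lambda>y. t + q * y) -` B) y \<partial>lborel)"
    by (intro nn_integral_cong) (simp split: split_indicator)
  also have "\<dots> = emeasure lborel ((\<lambda>y. t + q * y) -` B)" using m by simp
  finally show ?thesis using assms(2) by (simp add: measure_def enn2real_mult)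
qed

text \<open>At the scale \<open>r\<close> compactness gives a window of maximal measure, which is
  below \<open>2 * r\<close> because of a hole. \<open>T\<close> magnifies each smaller window by
  \<open>q\<close> into a window of the next larger scale, so the relative deficit persists at all
  scales.\<close>

lemma expanding_invariant_porous:
  fixes X :: "real set" and T :: "real \<Rightarrow> real"
  assumes X: "compact X" and q: "q > 1" and inv: "\<And>x. x \<in> X \<Longrightarrow> T x \<in> X" and g: "g > 0"
    and aff: "\<And>x y. x \<in> X \<Longrightarrow> y \<in> X \<Longrightarrow> \<bar>x - y\<bar> < g \<Longrightarrow> T x - T y = q * (x - y)"
  shows "\<exists>r>0. \<exists>\<rho>>0. \<forall>n. \<forall>x\<in>X. measure lborel (X \<inter> {x - r / q ^ n..x + r / q ^ n}) \<le> (2 * r - \<rho>) / q ^ n"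
proof (cases "X = {}")
  case True
  then show ?thesis by (auto intro!: exI[of _ 1])
next
  case False
  define r where "r = g / 2"
  have r: "r > 0" "r < g" using g unfolding r_def by auto
  define m where "m x s = measure lborel (X \<inter> {x - s..x + s})" for x s
  have XI: "X \<inter> {u..v} \<in> fmeasurable lborel" for u v
    using X by (intro fmeasurable_compact compact_Int_closed) auto
  have lip: "m x r \<le> m y r + 2 * \<bar>x - y\<bar>" for x y
  proof -
    let ?d = "\<bar>x - y\<bar>"
    \<comment> \<open>Moving the centre by \<open>?d\<close> adds at most one strip of length
      \<open>?d\<close> on either side.\<close>
    have "m x r \<le> measure lborel ((X \<inter> {y - r..y + r}) \<union> {y + r..y + r + ?d} \<union> {y - r - ?d..y - r})"
      unfolding m_def using fmeasurableD[OF XI] fmeasurable_compact[OF compact_Icc] XI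
      by (intro measure_mono_fmeasurable fmeasurable.Un) auto
    also have "\<dots> \<le> measure lborel ((X \<inter> {y - r..y + r}) \<union> {y + r..y + r + ?d}) + measure lborel {y - r - ?d..y - r}"
      by (intro measure_Un_le) (use X in \<open>auto dest: compact_imp_closed\<close>)
    also have "\<dots> \<le> m y r + measure lborel {y + r..y + r + ?d} + measure lborel {y - r - ?d..y - r}"
      unfolding m_def by (intro add_right_mono measure_Un_le) (use X in \<open>auto dest: compact_imp_closed\<close>)
    finally show ?thesis by simp
  qed
  have "continuous_on X (\<lambda>x. m x r)" unfolding continuous_on_iff
  proof (intro ballI allI impI)
    fix x e :: real assume "e > 0"
    have "dist (m x' r) (m x r) < e" if "dist x' x < e / 2" for x'
      using lip[of x x'] lip[of x' x] that abs_minus_commute[of x x']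
      unfolding dist_real_def abs_less_iff[of "m x' r - m x r"] by (intro conjI; linarith)
    then show "\<exists>d>0. \<forall>x'\<in>X. dist x' x < d \<longrightarrow> dist (m x' r) (m x r) < e"
      using \<open>e > 0\<close> by (intro exI[of _ "e / 2"]) auto
  qed
  then obtain y where y: "y \<in> X" "\<And>x. x \<in> X \<Longrightarrow> m x r \<le> m y r"
    using continuous_attains_sup[OF X False] by blast
  have "m y r < 2 * r"
  proof -
    \<comment> \<open>The half-size interval contains a point outside \<open>X\<close>, and a small
      closed ball around it is a hole inside the window of radius \<open>r\<close>.\<close>
    have "\<not> {y - r / 2..y + r / 2} \<subseteq> X"
      by (rule expanding_invariant_no_interval[OF compact_imp_bounded[OF X] q inv g aff]) (use r in auto)
    then obtain z where z: "y - r < z" "z < y + r" "z \<notin> X" using r by force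
    have "open (- X \<inter> {y - r<..<y + r})" using X by (intro open_Int) (auto dest: compact_imp_closed)
    moreover have "z \<in> - X \<inter> {y - r<..<y + r}" using z by simp
    ultimately obtain e where e: "e > 0" "cball z e \<subseteq> - X \<inter> {y - r<..<y + r}"
      unfolding open_contains_cball by blast
    have "z - e \<in> cball z e" "z + e \<in> cball z e" using e(1) by (auto simp: dist_real_def)
    then have "z - e \<in> {y - r<..<y + r}" "z + e \<in> {y - r<..<y + r}" using e(2) by blast+
    then have ze: "y - r < z - e" "z + e < y + r" by auto
    have "X \<inter> {y - r..y + r} \<subseteq> {y - r..z - e} \<union> {z + e..y + r}"
    proof
      fix w assume w: "w \<in> X \<inter> {y - r..y + r}"
      then have "w \<notin> cball z e" using e(2) by auto
      then show "w \<in> {y - r..z - e} \<union> {z + e..y + r}" using w by (auto simp: dist_real_def)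
    qed
    then have "m y r \<le> measure lborel ({y - r..z - e} \<union> {z + e..y + r})"
      unfolding m_def using fmeasurableD[OF XI] fmeasurable_compact[OF compact_Icc]
      by (intro measure_mono_fmeasurable fmeasurable.Un) auto
    also have "\<dots> \<le> measure lborel {y - r..z - e} + measure lborel {z + e..y + r}"
      by (intro measure_Un_le) auto
    also have "\<dots> < 2 * r" using ze e(1) by simp
    finally show ?thesis .
  qed
  \<comment> \<open>Since \<open>s / q < g\<close>, \<open>T\<close> is affine with slope
    \<open>q\<close> on this part of \<open>X\<close>, which therefore lies in an affine preimage of
    the window around \<open>T x\<close>.\<close>
  have scale: "m x (s / q) \<le> m (T x) s / q" if x: "x \<in> X" and s: "0 < s" "s \<le> r" for x s
  proof -
    let ?B = "X \<inter> {T x - s..T x + s}"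
    let ?f = "\<lambda>y. (T x - q * x) + q * y"
    have "s / q \<le> s / 1" using s q by (intro divide_left_mono) auto
    then have sq: "s / q < g" using s r by simp
    have "X \<inter> {x - s / q..x + s / q} \<subseteq> ?f -` ?B"
    proof
      fix y assume "y \<in> X \<inter> {x - s / q..x + s / q}"
      then have y: "y \<in> X" "\<bar>y - x\<bar> \<le> s / q" by auto
      then have Ty: "T y - T x = q * (y - x)" using aff[OF y(1) x] sq by simp
      have "\<bar>q * (y - x)\<bar> \<le> s" using y(2) q by (simp add: abs_mult pos_le_divide_eq mult.commute)
      then have "T y \<in> ?B" using inv[OF y(1)] Ty by auto
      moreover have "?f y = T y" using Ty by (simp add: algebra_simps)
      ultimately show "y \<in> ?f -` ?B" by simp
    qed
    moreover have "?f -` ?B \<in> fmeasurable lborel"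
    proof (rule fmeasurableI2)
      show "{x - s / q..x + s / q} \<in> fmeasurable lborel"
        by (intro fmeasurable_compact compact_Icc)
      show "?f -` ?B \<subseteq> {x - s / q..x + s / q}"
      proof
        fix y assume "y \<in> ?f -` ?B"
        then have "(x - y) * q \<le> s" "(y - x) * q \<le> s" by (auto simp: algebra_simps)
        then have "x - y \<le> s / q" "y - x \<le> s / q" using q by (simp_all add: pos_le_divide_eq)
        then show "y \<in> {x - s / q..x + s / q}" by auto
      qed
      show "?f -` ?B \<in> sets lborel"
        using measurable_sets[of ?f borel borel ?B] X by (auto dest: compact_imp_closed)
    qed
    ultimately have "m x (s / q) \<le> measure lborel (?f -` ?B)"
      unfolding m_def by (rule measure_mono_fmeasurable[OF _ fmeasurableD[OF XI]])
    also have "\<dots> = measure lborel ?B / q"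
      using measure_scaling_preimage[of ?B q "T x - q * x"] q X by (auto dest: compact_imp_closed)
    finally show ?thesis unfolding m_def .
  qed
  have "m x (r / q ^ n) \<le> m y r / q ^ n" if "x \<in> X" for x n
    using that
  proof (induction n arbitrary: x)
    case 0
    then show ?case using y by simp
  next
    case (Suc n)
    have "r / q ^ n \<le> r" using q r by (simp add: field_simps)
    then have "m x (r / q ^ n / q) \<le> m (T x) (r / q ^ n) / q"
      using r q Suc.prems by (intro scale) auto
    also have "\<dots> \<le> (m y r / q ^ n) / q"
      using Suc.IH[OF inv[OF Suc.prems]] q by (intro divide_right_mono) auto
    finally show ?case by (simp add: mult.commute)
  qed
  then show ?thesis using r(1) \<open>m y r < 2 * r\<close> unfolding m_def
    \<comment> \<open>The constant \<rho> is the deficit of the fullest window at scale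
      \<open>r\<close>.\<close>
    by (intro exI[of _ r] conjI exI[of _ "2 * r - m y r"]) (auto simp: m_def)
qed

text \<open>A uniform deficit at arbitrarily small scales rules out density points. The proof makes
  this quantitative by comparing \<open>X\<close> with its shrinking neighbourhoods
  \<open>N s\<close>.\<close>

lemma porous_null:
  fixes X :: "real set"
  assumes X: "compact X" and r: "r > 0" and \<rho>: "\<rho> > 0" and q: "q > 1"
    and por: "\<And>n x. x \<in> X \<Longrightarrow> measure lborel (X \<inter> {x - r / q ^ n..x + r / q ^ n}) \<le> (2 * r - \<rho>) / q ^ n"
  shows "X \<in> null_sets lborel"
proof (cases "X = {}")
  case False
  have cl: "closed X" using X by (rule compact_imp_closed)
  have Xf: "X \<in> fmeasurable lborel" using X by (rule fmeasurable_compact)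
  define N where "N s = {y. infdist y X \<le> s}" for s
  have Ncl: "closed (N s)" for s
    unfolding N_def by (intro closed_Collect_le continuous_intros)
  have XN: "X \<subseteq> N s" if "s \<ge> 0" for s using that by (auto simp: N_def)
  have Nb: "bounded (N s)" for s
  proof -
    obtain B where B: "\<And>x. x \<in> X \<Longrightarrow> \<bar>x\<bar> \<le> B" using X compact_imp_bounded by (fastforce simp: bounded_iff)
    have "\<bar>y\<bar> \<le> B + s" if "y \<in> N s" for y
    proof -
      obtain x where "x \<in> X" "infdist y X = dist y x" using infdist_attains_inf[OF cl False] by blast
      then show ?thesis using B[of x] that by (auto simp: N_def dist_real_def)
    qed
    then show ?thesis by (auto simp: bounded_iff)
  qed
  have Nf: "N s \<in> fmeasurable lborel" for s
    using Ncl Nb by (intro fmeasurable_compact) (simp add: compact_eq_bounded_closed)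
  txt \<open>Integrate the measure of \<open>X \<inter> {y - s..y + s}\<close> over \<open>y\<close>: by Fubini the total is \<open>2 s |X|\<close>,
    whereas porosity saves a fixed proportion over \<open>y \<in> X\<close>, and only the \<open>s\<close>-neighbourhood contributes.\<close>
  have key: "\<rho> * measure lborel X \<le> 2 * r * (measure lborel (N (r / q ^ n)) - measure lborel X)" for n
  proof -
    define s where "s = r / q ^ n"
    have s: "s > 0" using r q by (simp add: s_def)
    define \<theta> where "\<theta> = (2 * r - \<rho>) / q ^ n"
    obtain x0 where "x0 \<in> X" using False by auto
    then have \<theta>0: "\<theta> \<ge> 0" using por[of x0 n] unfolding \<theta>_def by (meson measure_nonneg order_trans)
    define Z where "Z = {(x::real, y::real). x \<in> X \<and> \<bar>x - y\<bar> \<le> s}"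
    have "closed ((X \<times> UNIV) \<inter> {p::real\<times>real. \<bar>fst p - snd p\<bar> \<le> s})"
      using cl by (intro closed_Int closed_Times closed_Collect_le continuous_intros) auto
    moreover have "(X \<times> UNIV) \<inter> {p::real\<times>real. \<bar>fst p - snd p\<bar> \<le> s} = Z" by (auto simp: Z_def)
    ultimately have Z: "Z \<in> sets (lborel \<Otimes>\<^sub>M lborel)"
      unfolding lborel_prod by simp
    have "emeasure (lborel \<Otimes>\<^sub>M lborel) Z = (\<integral>\<^sup>+x. emeasure lborel (Pair x -` Z) \<partial>lborel)"
      by (rule lborel.emeasure_pair_measure_alt[OF Z])
    also have "\<dots> = (\<integral>\<^sup>+x. ennreal (2 * s) * indicator X x \<partial>lborel)"
    proof (rule nn_integral_cong)
      fix x :: real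
      have "Pair x -` Z = (if x \<in> X then {x - s..x + s} else {})" by (auto simp: Z_def)
      then show "emeasure lborel (Pair x -` Z) = ennreal (2 * s) * indicator X x" using s by simp
    qed
    also have "\<dots> = ennreal (2 * s) * emeasure lborel X"
      using cl by (intro nn_integral_cmult_indicator) auto
    finally have left: "emeasure (lborel \<Otimes>\<^sub>M lborel) Z = ennreal (2 * s) * emeasure lborel X" .
    have "emeasure (lborel \<Otimes>\<^sub>M lborel) Z = (\<integral>\<^sup>+y. emeasure lborel ((\<lambda>x. (x, y)) -` Z) \<partial>lborel)"
      by (rule lborel_pair.emeasure_pair_measure_alt2[OF Z])
    also have "\<dots> \<le> (\<integral>\<^sup>+y. ennreal \<theta> * indicator X y + ennreal (2 * s) * indicator (N s - X) y \<partial>lborel)"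
    proof (rule nn_integral_mono)
      fix y :: real
      have eq: "(\<lambda>x. (x, y)) -` Z = X \<inter> {y - s..y + s}" by (auto simp: Z_def)
      have fm: "X \<inter> {y - s..y + s} \<in> fmeasurable lborel"
        using X by (intro fmeasurable_compact compact_Int_closed) auto
      consider "y \<in> X" | "y \<notin> X" "y \<in> N s" | "y \<notin> N s" "y \<notin> X" using XN[of s] s by auto
      then show "emeasure lborel ((\<lambda>x. (x, y)) -` Z) \<le> ennreal \<theta> * indicator X y + ennreal (2 * s) * indicator (N s - X) y"
      proof cases
        case 1
        then show ?thesis unfolding eq using por[OF 1, of n] fm
          by (simp add: emeasure_eq_measure2 s_def \<theta>_def ennreal_leI)
      next
        case 2
        have "emeasure lborel (X \<inter> {y - s..y + s}) \<le> emeasure lborel {y - s..y + s}"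
          by (intro emeasure_mono) auto
        then show ?thesis unfolding eq using 2 s by simp
      next
        case 3
        have "X \<inter> {y - s..y + s} = {}"
        proof (rule ccontr)
          assume "X \<inter> {y - s..y + s} \<noteq> {}"
          then obtain x where "x \<in> X" "x \<in> {y - s..y + s}" by blast
          then have "x \<in> X" "dist y x \<le> s" by (auto simp: dist_real_def)
          then show False using 3 infdist_le2 by (auto simp: N_def)
        qed
        then show ?thesis unfolding eq by simp
      qed
    qed
    also have "\<dots> = ennreal \<theta> * emeasure lborel X + ennreal (2 * s) * emeasure lborel (N s - X)"
    proof -
      have [measurable]: "X \<in> sets borel" "N s \<in> sets borel" using cl Ncl[of s] by auto
      show ?thesis by (subst nn_integral_add) (simp_all add: nn_integral_cmult_indicator)
    qed
    finally have "ennreal (2 * s) * emeasure lborel X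
        \<le> ennreal \<theta> * emeasure lborel X + ennreal (2 * s) * emeasure lborel (N s - X)"
      unfolding left .
    moreover have "N s - X \<in> fmeasurable lborel" using Nf Xf by (intro fmeasurable.Diff)
    ultimately have "ennreal (2 * s * measure lborel X)
        \<le> ennreal (\<theta> * measure lborel X + 2 * s * measure lborel (N s - X))"
      using s \<theta>0 Xf by (simp add: emeasure_eq_measure2 ennreal_mult)
    then have "2 * s * measure lborel X \<le> \<theta> * measure lborel X + 2 * s * measure lborel (N s - X)"
      using s \<theta>0 by (subst (asm) ennreal_le_iff) auto
    moreover have "measure lborel (N s - X) = measure lborel (N s) - measure lborel X"
      using Nf[of s] Xf XN[of s] s by (intro measure_Diff) (auto simp: fmeasurable_def)
    ultimately have "2 * s * measure lborel X \<le> \<theta> * measure lborel X + 2 * s * (measure lborel (N s) - measure lborel X)"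
      by simp
    \<comment> \<open>Multiplying by \<open>q ^ n\<close> removes the scale: \<rho> and
      \<open>r\<close> no longer depend on \<open>n\<close>, so the limit can be taken.\<close>
    then have "q ^ n * (2 * s * measure lborel X) \<le> q ^ n * (\<theta> * measure lborel X + 2 * s * (measure lborel (N s) - measure lborel X))"
      using q by (intro mult_left_mono) auto
    moreover have "q ^ n * \<theta> = 2 * r - \<rho>" "q ^ n * s = r" using q by (auto simp: \<theta>_def s_def)
    ultimately have "2 * r * measure lborel X \<le> (2 * r - \<rho>) * measure lborel X + 2 * r * (measure lborel (N s) - measure lborel X)"
      by (simp add: distrib_left mult.assoc[symmetric] mult.commute[of _ 2]) (simp add: mult.assoc)
    then show ?thesis unfolding s_def by (simp add: algebra_simps)
  qed
  \<comment> \<open>As \<open>X\<close> is closed, the neighbourhoods decrease to \<open>X\<close>,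
    and the right-hand side of \<open>key\<close> tends to 0.\<close>
  have "(\<lambda>n. measure lborel (N (r / q ^ n))) \<longlonglongrightarrow> measure lborel (\<Inter>n. N (r / q ^ n))"
  proof (rule Lim_measure_decseq)
    show "decseq (\<lambda>n. N (r / q ^ n))"
    proof (rule decseq_SucI)
      fix n
      have "r / q ^ Suc n \<le> r / q ^ n" using r q by (intro divide_left_mono) auto
      then show "N (r / q ^ Suc n) \<subseteq> N (r / q ^ n)" by (auto simp: N_def)
    qed
    show "emeasure lborel (N (r / q ^ n)) \<noteq> \<infinity>" for n using Nf[of "r / q ^ n"] by (auto simp: fmeasurable_def)
  qed (use Ncl in auto)
  moreover have "(\<Inter>n. N (r / q ^ n)) = X"
  proof
    show "X \<subseteq> (\<Inter>n. N (r / q ^ n))" using XN r q by (intro INT_greatest) simp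
    show "(\<Inter>n. N (r / q ^ n)) \<subseteq> X"
    proof
      fix y assume y: "y \<in> (\<Inter>n. N (r / q ^ n))"
      have "(\<lambda>n. r * (1 / q) ^ n) \<longlonglongrightarrow> r * 0"
        by (intro tendsto_mult tendsto_const LIMSEQ_power_zero) (use q in auto)
      then have "(\<lambda>n. r / q ^ n) \<longlonglongrightarrow> 0" by (simp add: power_one_over)
      moreover have "infdist y X \<le> r / q ^ n" for n using y by (auto simp: N_def)
      ultimately have "infdist y X \<le> 0" by (intro LIMSEQ_le_const[of "\<lambda>n. r / q ^ n"]) auto
      then show "y \<in> X" using in_closed_iff_infdist_zero[OF cl False] infdist_nonneg[of y X] by auto
    qed
  qed
  ultimately have "(\<lambda>n. 2 * r * (measure lborel (N (r / q ^ n)) - measure lborel X)) \<longlonglongrightarrow> 2 * r * (measure lborel X - measure lborel X)"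
    by (intro tendsto_intros) auto
  then have "\<rho> * measure lborel X \<le> 2 * r * (measure lborel X - measure lborel X)"
    by (rule LIMSEQ_le_const) (use key in auto)
  then have "measure lborel X = 0" using \<rho> measure_nonneg[of lborel X]
    by (simp add: mult_le_0_iff)
  then show ?thesis using emeasure_eq_measure2[OF Xf] fmeasurableD[OF Xf] by (simp add: null_setsI)
qed simp

lemma expanding_invariant_null:
  fixes X :: "real set" and T :: "real \<Rightarrow> real"
  assumes X: "compact X" and q: "q > 1" and inv: "\<And>x. x \<in> X \<Longrightarrow> T x \<in> X" and g: "g > 0"
    and aff: "\<And>x y. x \<in> X \<Longrightarrow> y \<in> X \<Longrightarrow> \<bar>x - y\<bar> < g \<Longrightarrow> T x - T y = q * (x - y)"
  shows "X \<in> null_sets lborel"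
  using expanding_invariant_porous[OF assms] porous_null[OF X _ _ q] by metis

section \<open>The closure is a null set\<close>

text \<open>Limit version of \<open>univoque_digit\<close>, with weak inequalities. Only finitely
  many digits occur in the strip \<open>S\<close>, and each gives a closed condition
  \<open>F k\<close>, so their union is closed.\<close>

lemma closure_univoque_digit:
  assumes cl: "(x, q) \<in> closure univoque_set" and q: "real_of_int m < q" "q < real_of_int m + 1" "q > 1"
  shows "0 \<le> x \<and> x \<le> real_of_int m / (q - 1) \<and>
    (\<exists>k. 0 \<le> k \<and> k \<le> m \<and> (q * x - real_of_int k, q) \<in> closure univoque_set
      \<and> (k < m \<longrightarrow> q * x - real_of_int k \<le> 1)
      \<and> (0 < k \<longrightarrow> real_of_int m / (q - 1) - (q * x - real_of_int k) \<le> 1))"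
proof -
  \<comment> \<open>Inequalities with denominator \<open>snd p - 1\<close> are multiplied out, so
    that both sides are continuous on the whole plane.\<close>
  define F where "F k = {p. 0 \<le> fst p \<and> fst p * (snd p - 1) \<le> real_of_int m
    \<and> (k < m \<longrightarrow> snd p * fst p - real_of_int k \<le> 1)
    \<and> (0 < k \<longrightarrow> real_of_int m \<le> (1 + (snd p * fst p - real_of_int k)) * (snd p - 1))
    \<and> (snd p * fst p - real_of_int k, snd p) \<in> closure univoque_set}" for k :: int
  define S where "S = {p :: real \<times> real. real_of_int m < snd p \<and> snd p < real_of_int m + 1}"
  have "closed (F k)" for k
  proof -
    have "closed ((\<lambda>p. (snd p * fst p - real_of_int k, snd p)) -` closure univoque_set)"
      by (intro closed_vimage closed_closure continuous_intros)
    then have "closed {p. (snd p * fst p - real_of_int k, snd p) \<in> closure univoque_set}"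
      by (simp add: vimage_def)
    then show ?thesis unfolding F_def
      by (intro closed_Collect_conj closed_Collect_imp open_Collect_const closed_Collect_le continuous_intros)
  qed
  then have clF: "closed (\<Union>k\<in>{0..m}. F k)" by (intro closed_UN) auto
  have "S \<inter> univoque_set \<subseteq> (\<Union>k\<in>{0..m}. F k)"
  proof
    fix p assume p: "p \<in> S \<inter> univoque_set"
    obtain u v where uv: "p = (u, v)" by force
    have U: "(u, v) \<in> univoque_set" and v: "real_of_int m < v" "v < real_of_int m + 1"
      using p uv unfolding S_def by auto
    have "\<lceil>v\<rceil> = m + 1" using v by (intro ceiling_unique) auto
    then have M: "max_digit v = m" by simp
    have "v > 1" using univoque_bounds[OF U] by simp
    obtain k where "0 \<le> k" "k \<le> m" "(v * u - real_of_int k, v) \<in> univoque_set"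
        "k < m \<longrightarrow> v * u - real_of_int k < 1"
        "0 < k \<longrightarrow> real_of_int m / (v - 1) - (v * u - real_of_int k) < 1"
      using univoque_digit[OF U] unfolding M by blast
    then have "p \<in> F k" using univoque_bounds[OF U] closure_subset[of univoque_set] \<open>v > 1\<close>
      unfolding F_def uv M by (auto simp: pos_le_divide_eq diff_less_eq pos_divide_less_eq)
    then show "p \<in> (\<Union>k\<in>{0..m}. F k)" using \<open>0 \<le> k\<close> \<open>k \<le> m\<close> by auto
  qed
  then have "closure (S \<inter> univoque_set) \<subseteq> (\<Union>k\<in>{0..m}. F k)" using clF by (rule closure_minimal)
  moreover have "open S" unfolding S_def
    by (intro open_Collect_conj open_Collect_less continuous_intros)
  \<comment> \<open>Since \<open>S\<close> is open, points of the closure in \<open>S\<close> are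
    limits of univoque points in \<open>S\<close>, where the largest digit is
    \<open>m\<close>.\<close>
  then have "S \<inter> closure univoque_set \<subseteq> closure (S \<inter> univoque_set)" by (rule open_Int_closure_subset)
  moreover have "(x, q) \<in> S" using q by (simp add: S_def)
  ultimately obtain k where "k \<in> {0..m}" "(x, q) \<in> F k" using cl by blast
  then show ?thesis using q(3) unfolding F_def by (auto simp: pos_le_divide_eq diff_le_eq pos_divide_le_eq)
qed

lemma closure_univoque_slice_null:
  assumes "q \<notin> \<int>"
  shows "{x. (x, q) \<in> closure univoque_set} \<in> null_sets lborel"
proof (cases "q > 1")
  case False
  have "univoque_set \<subseteq> {p. 1 \<le> snd p}" by (auto simp: univoque_set_def)
  then have "closure univoque_set \<subseteq> {p. 1 \<le> snd p}"
    by (rule closure_minimal) (intro closed_Collect_le continuous_intros)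
  moreover have "q \<noteq> 1" using assms by auto
  ultimately have "{x. (x, q) \<in> closure univoque_set} = {}" using False by auto
  then show ?thesis by simp
next
  case True
  define m where "m = \<lfloor>q\<rfloor>"
  define L where "L = real_of_int m / (q - 1)"
  have "real_of_int m \<noteq> q" using assms by (metis Ints_of_int)
  then have m: "real_of_int m < q" "q < real_of_int m + 1" unfolding m_def by linarith+
  \<comment> \<open>Non-integrality enters here: \<open>m > q - 1\<close> makes \<open>L\<close>
    exceed 1, and this excess produces the gap between digits.\<close>
  have L: "L > 1" using m True unfolding L_def by (simp add: field_simps)
  define X where "X = {x. (x, q) \<in> closure univoque_set}"
  have "closed ((\<lambda>x. (x, q)) -` closure univoque_set)"
    by (intro closed_vimage closed_closure continuous_intros)
  then have "closed X" by (simp add: X_def vimage_def)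
  have digit: "0 \<le> x \<and> x \<le> L \<and> (\<exists>k. 0 \<le> k \<and> k \<le> m \<and> q * x - real_of_int k \<in> X
      \<and> (k < m \<longrightarrow> q * x - real_of_int k \<le> 1) \<and> (0 < k \<longrightarrow> L - (q * x - real_of_int k) \<le> 1))"
    if "x \<in> X" for x
    using closure_univoque_digit[OF _ m True, of x] that unfolding X_def L_def by blast
  have "bounded X" using digit by (intro boundedI[of _ L]) auto
  then have "compact X" using \<open>closed X\<close> by (simp add: compact_eq_bounded_closed)
  obtain k where k: "\<And>x. x \<in> X \<Longrightarrow> 0 \<le> k x \<and> k x \<le> m \<and> q * x - real_of_int (k x) \<in> X
      \<and> (k x < m \<longrightarrow> q * x - real_of_int (k x) \<le> 1) \<and> (0 < k x \<longrightarrow> L - (q * x - real_of_int (k x)) \<le> 1)"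
    using digit by metis
  \<comment> \<open>The smaller digit is below \<open>m\<close>, so its tail is at most 1; the
    larger is positive, so its tail is at least \<open>L - 1\<close>. The digits themselves differ
    by at least 1.\<close>
  have sep: "L - 1 \<le> q * (y - x)" if "x \<in> X" "y \<in> X" "k x < k y" for x y
  proof -
    have "q * x - real_of_int (k x) \<le> 1" using k[OF that(1)] k[OF that(2)] that(3) by auto
    moreover have "L - (q * y - real_of_int (k y)) \<le> 1" using k[OF that(1)] k[OF that(2)] that(3) by auto
    moreover have "real_of_int (k x) + 1 \<le> real_of_int (k y)" using that(3) by linarith
    ultimately show ?thesis by (simp add: right_diff_distrib)
  qed
  have "X \<in> null_sets lborel"
  proof (rule expanding_invariant_null[OF \<open>compact X\<close> True, of "\<lambda>x. q * x - real_of_int (k x)" "(L - 1) / q"])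
    show "(L - 1) / q > 0" using L True by simp
    fix x assume x: "x \<in> X"
    then show "q * x - real_of_int (k x) \<in> X" using k by blast
    fix y assume y: "y \<in> X" and near: "\<bar>x - y\<bar> < (L - 1) / q"
    then have "q * \<bar>x - y\<bar> < L - 1" using True by (simp add: field_simps)
    moreover have "q * (y - x) \<le> q * \<bar>x - y\<bar>" "q * (x - y) \<le> q * \<bar>x - y\<bar>"
      using True by (auto intro!: mult_left_mono)
    ultimately have "k x = k y" using sep[OF x y] sep[OF y x] by force
    then show "q * x - real_of_int (k x) - (q * y - real_of_int (k y)) = q * (x - y)"
      by (simp add: right_diff_distrib)
  qed
  then show ?thesis unfolding X_def .
qed

lemma closure_univoque_null: "closure univoque_set \<in> null_sets lborel"
proof -
  have m: "closure univoque_set \<in> sets (lborel \<Otimes>\<^sub>M lborel)" unfolding lborel_prod by simp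
  have "countable (\<int> :: real set)" unfolding Ints_def by simp
  then have "AE q in lborel. q \<notin> (\<int> :: real set)" by (intro AE_not_in countable_imp_null_set_lborel)
  then have "AE q in lborel. emeasure lborel ((\<lambda>x. (x, q)) -` closure univoque_set) = 0"
    by eventually_elim (use closure_univoque_slice_null in \<open>auto simp: vimage_def null_sets_def\<close>)
  then have "(\<integral>\<^sup>+q. emeasure lborel ((\<lambda>x. (x, q)) -` closure univoque_set) \<partial>lborel) = (\<integral>\<^sup>+q. 0 \<partial>(lborel :: real measure))"
    by (intro nn_integral_cong_AE)
  then have "emeasure (lborel \<Otimes>\<^sub>M lborel) (closure univoque_set) = 0"
    unfolding lborel_pair.emeasure_pair_measure_alt2[OF m] by simp
  then show ?thesis using m unfolding lborel_prod by blast
qed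

section \<open>Hausdorff measure in the plane\<close>

lemma hausdorff_approx_le:
  assumes "A \<subseteq> \<Union>(range C)" "\<And>n. bounded (C n)" "\<And>n. diameter (C n) \<le> \<delta>"
  shows "hausdorff_approx s \<delta> A \<le> (\<Sum>n. hdiam_pow s (C n))"
  unfolding hausdorff_approx_def using assms by (intro INF_lower) auto

lemma hausdorff_measure_mono:
  assumes "A \<subseteq> B"
  shows "hausdorff_measure s A \<le> hausdorff_measure s B"
  unfolding hausdorff_measure_def hausdorff_approx_def
  by (intro SUP_mono' INF_superset_mono) (use assms in auto)

lemma grid_cell_exists:
  fixes R x :: real
  assumes "N \<ge> 1" "0 < R" "-R \<le> x" "x < R"
  shows "\<exists>a<N. -R + real a * (2 * R / real N) \<le> x \<and> x \<le> -R + (real a + 1) * (2 * R / real N)"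
proof -
  define z where "z = (x + R) * real N / (2 * R)"
  have "0 \<le> (x + R) * real N" using assms by (intro mult_nonneg_nonneg) auto
  then have z: "0 \<le> z" "z < real N" using assms by (simp_all add: z_def field_simps)
  have x: "x = -R + z * (2 * R / real N)" using assms by (simp add: z_def)
  have fl: "real (nat \<lfloor>z\<rfloor>) \<le> z" "z \<le> real (nat \<lfloor>z\<rfloor>) + 1" using z by linarith+
  have "real (nat \<lfloor>z\<rfloor>) < real N" using fl z by linarith
  moreover have "real (nat \<lfloor>z\<rfloor>) * (2 * R / real N) \<le> z * (2 * R / real N)"
    "z * (2 * R / real N) \<le> (real (nat \<lfloor>z\<rfloor>) + 1) * (2 * R / real N)"
    using fl assms by (simp_all only: mult_right_mono divide_nonneg_nonneg of_nat_0_le_iff mult_nonneg_nonneg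
        zero_le_numeral less_imp_le)
  ultimately show ?thesis unfolding x by (intro exI[of _ "nat \<lfloor>z\<rfloor>"]) auto
qed

text \<open>The square is cut into \<open>N * N\<close> cells of diameter at most
  \<open>4 * R / N\<close>, with total cost at most \<open>(4 * R) powr s * N powr (2 - s)\<close>,
  which tends to 0.\<close>

lemma plane_square_cover:
  fixes R :: real
  assumes "s > 2" "\<delta> > 0" "\<eta> > 0" "R > 0"
  shows "\<exists>C :: nat \<Rightarrow> (real \<times> real) set. {-R..<R} \<times> {-R..<R} \<subseteq> \<Union>(range C)
    \<and> (\<forall>n. bounded (C n) \<and> diameter (C n) \<le> \<delta>) \<and> (\<Sum>n. hdiam_pow s (C n)) \<le> ennreal \<eta>"
proof -
  have "(\<lambda>N. (4 * R) powr s * real N powr (2 - s)) \<longlonglongrightarrow> (4 * R) powr s * 0"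
    using assms by (intro tendsto_mult tendsto_const tendsto_neg_powr filterlim_real_sequentially) auto
  then have "\<forall>\<^sub>F N in sequentially. (4 * R) powr s * real N powr (2 - s) < \<eta>"
    using assms by (intro order_tendstoD(2)) auto
  moreover have "(\<lambda>N. 4 * R / real N) \<longlonglongrightarrow> 0" by (rule lim_const_over_n)
  then have "\<forall>\<^sub>F N in sequentially. 4 * R / real N < \<delta>"
    using assms by (intro order_tendstoD(2)) auto
  moreover have "\<forall>\<^sub>F N in sequentially. N \<ge> (1::nat)" by (rule eventually_ge_at_top)
  ultimately have "\<forall>\<^sub>F N in sequentially. (4 * R) powr s * real N powr (2 - s) < \<eta> \<and> 4 * R / real N < \<delta> \<and> N \<ge> 1"
    by eventually_elim simp
  then obtain N where N: "(4 * R) powr s * real N powr (2 - s) < \<eta>" "4 * R / real N < \<delta>" "N \<ge> 1"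
    using eventually_happens'[OF sequentially_bot] by blast
  define h where "h = 2 * R / real N"
  have h: "h > 0" using N assms by (simp add: h_def)
  define I where "I a = {-R + real a * h..-R + (real a + 1) * h}" for a :: nat
  \<comment> \<open>Cells are numbered row by row; the sequence continues with empty sets, whose
    \<open>hdiam_pow\<close> is 0.\<close>
  define C where "C j = (if j < N * N then I (j div N) \<times> I (j mod N) else {})" for j
  have d: "dist p p' \<le> 2 * h" if "p \<in> C j" "p' \<in> C j" for p p' j
  proof -
    have "\<bar>fst p - fst p'\<bar> \<le> h" "\<bar>snd p - snd p'\<bar> \<le> h"
      using that by (auto simp: C_def I_def distrib_right split: if_splits)
    moreover have "dist p p' \<le> \<bar>fst p - fst p'\<bar> + \<bar>snd p - snd p'\<bar>"
      using norm_Pair_le[of "fst (p - p')" "snd (p - p')"] by (simp add: dist_norm minus_prod_def)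
    ultimately show ?thesis by linarith
  qed
  have diam: "diameter (C j) \<le> 2 * h" for j
    using d h by (intro diameter_le) (auto simp: dist_norm)
  have bdd: "bounded (C j)" for j
    unfolding bounded_def using d by (metis all_not_in_conv)
  have "{-R..<R} \<times> {-R..<R} \<subseteq> \<Union>(range C)"
  proof
    fix p assume "p \<in> {-R..<R} \<times> {-R..<R}"
    then obtain u v where p: "p = (u, v)" "-R \<le> u" "u < R" "-R \<le> v" "v < R" by auto
    obtain a where a: "a < N" "u \<in> I a"
      using grid_cell_exists[OF N(3) assms(4) p(2,3)] unfolding I_def h_def by auto
    obtain b where b: "b < N" "v \<in> I b"
      using grid_cell_exists[OF N(3) assms(4) p(4,5)] unfolding I_def h_def by auto
    have "a * N + b < a * N + N" using b by simp
    also have "\<dots> = (a + 1) * N" by simp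
    also have "\<dots> \<le> N * N" using a by (intro mult_right_mono) auto
    finally have "p \<in> C (a * N + b)" unfolding C_def p using a b by simp
    then show "p \<in> \<Union>(range C)" by blast
  qed
  moreover have "diameter (C j) \<le> \<delta>" for j
    using diam[of j] N(2) by (simp add: h_def)
  moreover have "(\<Sum>n. hdiam_pow s (C n)) \<le> ennreal \<eta>"
  proof -
    have le: "hdiam_pow s (C j) \<le> ennreal ((2 * h) powr s)" for j
      unfolding hdiam_pow_def using assms diam[of j] diameter_ge_0[OF bdd]
      by (auto intro!: ennreal_leI powr_mono2)
    have "(\<Sum>n. hdiam_pow s (C n)) = (\<Sum>n<N * N. hdiam_pow s (C n))"
      by (rule suminf_finite) (auto simp: C_def hdiam_pow_def)
    also have "\<dots> \<le> (\<Sum>n<N * N. ennreal ((2 * h) powr s))" by (intro sum_mono le)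
    also have "\<dots> = ennreal (real (N * N) * (2 * h) powr s)"
      by (simp add: ennreal_mult ennreal_of_nat_eq_real_of_nat)
    also have "real (N * N) * (2 * h) powr s = (4 * R) powr s * real N powr (2 - s)"
    proof -
      have "(2 * h) powr s = (4 * R) powr s / real N powr s"
        using assms N by (simp add: h_def powr_divide)
      moreover have "real N powr (2 - s) = real (N * N) / real N powr s"
        using N by (simp add: powr_diff power2_eq_square)
      ultimately show ?thesis by simp
    qed
    also have "ennreal \<dots> \<le> ennreal \<eta>" using N(1) by (intro ennreal_leI) simp
    finally show ?thesis .
  qed
  ultimately show ?thesis using bdd by blast
qed

text \<open>The plane is exhausted by squares, the \<open>i\<close>-th covered at cost at most
  \<epsilon> / 2^(i+1), and the double sequence of covering sets is merged into one.\<close>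

lemma hausdorff_measure_plane_eq_0:
  fixes A :: "(real \<times> real) set"
  assumes "s > 2"
  shows "hausdorff_measure s A = 0"
proof -
  have "hausdorff_approx s \<delta> A = 0" if \<delta>: "\<delta> > 0" for \<delta>
  proof -
    have eps: "hausdorff_approx s \<delta> A \<le> 0 + ennreal \<epsilon>" if \<epsilon>: "\<epsilon> > 0" for \<epsilon>
    proof -
      let ?Q = "\<lambda>i::nat. {-(real i + 1)..<real i + 1} \<times> {-(real i + 1)..<real i + 1}"
      have "\<forall>i. \<exists>C :: nat \<Rightarrow> (real \<times> real) set. ?Q i \<subseteq> \<Union>(range C)
        \<and> (\<forall>n. bounded (C n) \<and> diameter (C n) \<le> \<delta>) \<and> (\<Sum>n. hdiam_pow s (C n)) \<le> ennreal (\<epsilon> * (1 / 2) ^ Suc i)"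
        using \<epsilon> by (intro allI plane_square_cover[OF assms \<delta>]) auto
      then obtain C :: "nat \<Rightarrow> nat \<Rightarrow> (real \<times> real) set" where C: "\<And>i. ?Q i \<subseteq> \<Union>(range (C i))"
          "\<And>i n. bounded (C i n)" "\<And>i n. diameter (C i n) \<le> \<delta>"
          "\<And>i. (\<Sum>n. hdiam_pow s (C i n)) \<le> ennreal (\<epsilon> * (1 / 2) ^ Suc i)"
        by metis
      define D where "D n = (case prod_decode n of (i, j) \<Rightarrow> C i j)" for n
      have "A \<subseteq> \<Union>(range D)"
      proof
        fix p assume "p \<in> A"
        obtain n :: nat where "max \<bar>fst p\<bar> \<bar>snd p\<bar> < real n" using reals_Archimedean2 by blast
        then have "p \<in> ?Q n" by (cases p) auto
        then obtain j where "p \<in> C n j" using C(1) by blast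
        then have "p \<in> D (prod_encode (n, j))" by (simp add: D_def)
        then show "p \<in> \<Union>(range D)" by blast
      qed
      then have "hausdorff_approx s \<delta> A \<le> (\<Sum>n. hdiam_pow s (D n))"
        by (rule hausdorff_approx_le) (use C in \<open>auto simp: D_def split: prod.split\<close>)
      also have "\<dots> = (\<Sum>n. (case prod_decode n of (i, j) \<Rightarrow> hdiam_pow s (C i j)))"
        by (intro suminf_cong) (simp add: D_def split: prod.split)
      also have "\<dots> = (\<Sum>i. \<Sum>j. hdiam_pow s (C i j))"
        by (rule suminf_ennreal_2dimen) simp
      also have "\<dots> \<le> (\<Sum>i. ennreal (\<epsilon> * (1 / 2) ^ Suc i))"
        by (intro suminf_le C(4)) auto
      also have "\<dots> = ennreal \<epsilon>"
        using sums_mult[OF power_half_series, of \<epsilon>] \<epsilon> by (intro suminf_ennreal_eq) auto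
      finally show ?thesis by simp
    qed
    have "hausdorff_approx s \<delta> A \<le> 0" by (rule ennreal_le_epsilon) (erule eps)
    then show ?thesis by simp
  qed
  then show ?thesis unfolding hausdorff_measure_def by (simp add: SUP_eq_const)
qed

lemma hausdorff_dim_plane_eq_2:
  fixes A :: "(real \<times> real) set"
  assumes "\<And>s. 0 \<le> s \<Longrightarrow> s < 2 \<Longrightarrow> hausdorff_measure s A \<noteq> 0"
  shows "hausdorff_dim A = 2"
proof (rule antisym)
  show "hausdorff_dim A \<le> 2"
  proof (rule ccontr)
    assume "\<not> hausdorff_dim A \<le> 2"
    then have "2 < hausdorff_dim A" by (simp only: not_le)
    then obtain s where s: "2 < ereal s" "ereal s < hausdorff_dim A" using ereal_dense2 by blast
    have "s > 2" using s(1) by simp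
    then have "ereal s \<in> {ereal s | s. 0 \<le> s \<and> hausdorff_measure s A = 0}"
      using hausdorff_measure_plane_eq_0[of s A] by auto
    then have "hausdorff_dim A \<le> ereal s" unfolding hausdorff_dim_def by (rule Inf_lower)
    with s(2) show False by simp
  qed
  show "2 \<le> hausdorff_dim A" unfolding hausdorff_dim_def
  proof (rule Inf_greatest)
    fix z assume "z \<in> {ereal s | s. 0 \<le> s \<and> hausdorff_measure s A = 0}"
    then obtain s where "z = ereal s" "0 \<le> s" "hausdorff_measure s A = 0" by auto
    then show "2 \<le> z" using assms[of s] by (cases "s < 2") auto
  qed
qed

section \<open>Lower bound for the dimension\<close>

text \<open>Every tail and its reflection are at most \<open>(M - 1) / (q - 1)\<close> for the
  largest digit \<open>M\<close>, and this is below 1 because \<open>M < q\<close>.\<close>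

lemma univoque_if_inner_digits:
  assumes q: "q > 1" and c: "\<forall>n. 1 \<le> c n \<and> c n \<le> max_digit q - 1"
  shows "(base_value q c, q) \<in> univoque_set"
proof -
  have e: "is_expansion q (base_value q c) c"
    unfolding is_expansion_iff[OF q]
  proof (intro conjI allI)
    show "0 \<le> c n" "c n \<le> max_digit q" for n using c[rule_format, of n] by auto
  qed simp
  have t: "real_of_int 1 / (q - 1) \<le> base_value q (\<lambda>i. c (Suc n + i))"
    "base_value q (\<lambda>i. c (Suc n + i)) \<le> real_of_int (max_digit q - 1) / (q - 1)" for n
    using base_value_ge[OF q, of 1 "\<lambda>i. c (Suc n + i)" "max_digit q - 1"]
      base_value_le[OF q, of 1 "\<lambda>i. c (Suc n + i)" "max_digit q - 1"] c by blast+
  have "real_of_int (max_digit q - 1) / (q - 1) < 1" using q max_digit_ge(3)[of q] by simp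
  moreover have "real_of_int (max_digit q) / (q - 1) = real_of_int 1 / (q - 1) + real_of_int (max_digit q - 1) / (q - 1)"
    by (simp add: add_divide_distrib[symmetric])
  ultimately show ?thesis unfolding univoque_iff[OF q e] using t by (smt (verit))
qed

text \<open>The first differing digits differ by at least 1, while the tails differ by at most
  \<open>1 - 1 / q\<close>. The remaining \<open>1 / q\<close> is divided by
  \<open>q ^ (n + 1)\<close>.\<close>

lemma base_value_separation:
  assumes q: "real_of_int m + 1 < q" "q > 1"
    and c: "\<forall>n. 1 \<le> c n \<and> c n \<le> m" and e: "\<forall>n. 1 \<le> e n \<and> e n \<le> m"
    and n: "\<And>i. i < n \<Longrightarrow> c i = e i" "c n \<noteq> e n"
  shows "1 / q ^ (n + 2) \<le> \<bar>base_value q c - base_value q e\<bar>"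
proof -
  have tail: "1 / (q - 1) \<le> base_value q (\<lambda>i. f (k + i)) \<and> base_value q (\<lambda>i. f (k + i)) \<le> real_of_int m / (q - 1)"
    if "\<forall>n. 1 \<le> f n \<and> f n \<le> m" for f k
    using base_value_ge[OF q(2), of 1 "\<lambda>i. f (k + i)" m] base_value_le[OF q(2), of 1 "\<lambda>i. f (k + i)" m] that by auto
  let ?c = "base_value q (\<lambda>i. c (Suc n + i))" and ?e = "base_value q (\<lambda>i. e (Suc n + i))"
  have diff: "base_value q (\<lambda>i. c (n + i)) - base_value q (\<lambda>i. e (n + i))
      = q ^ n * (base_value q c - base_value q e)"
    by (rule base_value_diff_tails[OF q(2) c e]) (rule n(1))
  have "q * (q ^ n * (base_value q c - base_value q e))
      = q * (base_value q (\<lambda>i. c (n + i)) - base_value q (\<lambda>i. e (n + i)))"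
    by (simp only: diff)
  also have "\<dots> = q * base_value q (\<lambda>i. c (n + i)) - q * base_value q (\<lambda>i. e (n + i))"
    by (rule right_diff_distrib)
  also have "\<dots> = (real_of_int (c n) + ?c) - (real_of_int (e n) + ?e)"
    by (simp only: base_value_tail[OF q(2) c, of n] base_value_tail[OF q(2) e, of n])
  also have "\<dots> = real_of_int (c n) - real_of_int (e n) + (?c - ?e)"
    by (rule add_diff_add)
  finally have eq: "q * (q ^ n * (base_value q c - base_value q e))
      = real_of_int (c n) - real_of_int (e n) + (?c - ?e)" .
  have "real_of_int m / (q - 1) \<le> 1" using q by (simp add: pos_divide_le_eq)
  moreover have "1 / q \<le> 1 / (q - 1)" using q by (intro divide_left_mono) auto
  ultimately have small: "\<bar>?c - ?e\<bar> \<le> 1 - 1 / q"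
    using tail[OF c, of "Suc n"] tail[OF e, of "Suc n"] by linarith
  have "1 \<le> \<bar>real_of_int (c n) - real_of_int (e n)\<bar>" using n(2) by linarith
  then have "1 / q \<le> \<bar>q * (q ^ n * (base_value q c - base_value q e))\<bar>"
    unfolding eq using small by linarith
  also have "\<dots> = q * q ^ n * \<bar>base_value q c - base_value q e\<bar>"
    using q by (simp add: abs_mult)
  finally have "1 / q \<le> q * q ^ n * \<bar>base_value q c - base_value q e\<bar>" .
  then have "1 / q / (q * q ^ n) \<le> \<bar>base_value q c - base_value q e\<bar>"
    using q by (subst pos_divide_le_eq) (auto simp: mult.commute)
  then show ?thesis by (simp add: mult_ac)
qed

text \<open>The base-\<open>m\<close> digits of \<open>y\<close>, shifted from \<open>{0..m-1}\<close> to \<open>{1..m}\<close>, so that in every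
  base from \<open>m + 1\<close> to \<open>m + 2\<close> they form a unique expansion.\<close>
definition shifted_digit :: "int \<Rightarrow> real \<Rightarrow> nat \<Rightarrow> int" where
  "shifted_digit m y n = 1 + \<lfloor>real_of_int m ^ Suc n * y\<rfloor> - m * \<lfloor>real_of_int m ^ n * y\<rfloor>"

lemma shifted_digit_bounds:
  assumes "m \<ge> 1"
  shows "1 \<le> shifted_digit m y n \<and> shifted_digit m y n \<le> m"
proof -
  define z where "z = real_of_int m ^ n * y"
  have "real_of_int m * real_of_int \<lfloor>z\<rfloor> \<le> real_of_int m * z"
    using assms by (intro mult_left_mono) auto
  then have 1: "m * \<lfloor>z\<rfloor> \<le> \<lfloor>real_of_int m * z\<rfloor>" by (simp add: le_floor_iff)
  have "real_of_int m * z < real_of_int m * (real_of_int \<lfloor>z\<rfloor> + 1)"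
    using assms by (intro mult_strict_left_mono) auto
  then have "\<lfloor>real_of_int m * z\<rfloor> < m * \<lfloor>z\<rfloor> + m" by (simp add: floor_less_iff distrib_left)
  with 1 show ?thesis unfolding shifted_digit_def z_def by (simp add: mult.assoc)
qed

text \<open>Strings agreeing in \<open>n\<close> digits are \<open>m^(-n)\<close>-close as parameters but separated by about
  \<open>q^(-n)\<close> as values, whence the exponent \<open>t\<close>.\<close>
lemma shifted_digit_holder:
  assumes m: "m \<ge> 2" "(real_of_int m + 2) powr t \<le> real_of_int m" and t: "t > 0"
    and q: "real_of_int m + 1 < q" "q \<le> real_of_int m + 2"
    and y: "0 \<le> y" "y < 1" "0 \<le> y'" "y' < 1"
  shows "\<bar>y - y'\<bar> \<le> real_of_int (m\<^sup>2) * \<bar>base_value q (shifted_digit m y) - base_value q (shifted_digit m y')\<bar> powr t"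
proof (cases "y = y'")
  case False
  define x where "x = \<bar>base_value q (shifted_digit m y) - base_value q (shifted_digit m y')\<bar>"
  \<comment> \<open>\<open>P n\<close> says that the parameters lie in different
    \<open>m\<close>-adic intervals of level \<open>n + 1\<close>; at the least such
    \<open>n\<close> the digits first differ.\<close>
  define P where "P n \<longleftrightarrow> \<lfloor>real_of_int m ^ Suc n * y\<rfloor> \<noteq> \<lfloor>real_of_int m ^ Suc n * y'\<rfloor>" for n
  have floor_eq: "real_of_int m ^ n * \<bar>y - y'\<bar> < 1"
    if "\<lfloor>real_of_int m ^ n * y\<rfloor> = \<lfloor>real_of_int m ^ n * y'\<rfloor>" for n
  proof -
    have "real_of_int m ^ n * \<bar>y - y'\<bar> = \<bar>real_of_int m ^ n * y - real_of_int m ^ n * y'\<bar>"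
      using m by (simp add: abs_mult right_diff_distrib[symmetric])
    also have "\<dots> < 1" using that by linarith
    finally show ?thesis .
  qed
  have ex: "\<exists>n. P n"
  proof -
    obtain n where n: "1 / \<bar>y - y'\<bar> < real_of_int m ^ n"
      using real_arch_pow[of "real_of_int m"] m by auto
    also have "\<dots> \<le> real_of_int m ^ Suc n" using m by simp
    finally have "1 < real_of_int m ^ Suc n * \<bar>y - y'\<bar>" using False by (simp add: field_simps)
    then show ?thesis using floor_eq[of "Suc n"] unfolding P_def by force
  qed
  define n where "n = (LEAST n. P n)"
  have Pn: "P n" using LeastI_ex[OF ex] unfolding n_def .
  have less: "\<not> P i" if "i < n" for i using not_less_Least that unfolding n_def by blast
  have fl: "\<lfloor>real_of_int m ^ i * y\<rfloor> = \<lfloor>real_of_int m ^ i * y'\<rfloor>" if "i \<le> n" for i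
  proof (cases i)
    case 0
    have "\<lfloor>y\<rfloor> = 0" "\<lfloor>y'\<rfloor> = 0" using y by (auto intro!: floor_unique)
    then show ?thesis using 0 by simp
  next
    case (Suc j)
    then show ?thesis using less[of j] that unfolding P_def by simp
  qed
  have agree: "shifted_digit m y i = shifted_digit m y' i" if "i < n" for i
    using fl[of i] fl[of "Suc i"] that unfolding shifted_digit_def by simp
  have differ: "shifted_digit m y n \<noteq> shifted_digit m y' n"
    using fl[of n] Pn unfolding shifted_digit_def P_def by simp
  have "1 / q ^ (n + 2) \<le> x" unfolding x_def
    using m q shifted_digit_bounds[of m] agree differ by (intro base_value_separation[of m]) auto
  moreover have "1 / (real_of_int m + 2) ^ (n + 2) \<le> 1 / q ^ (n + 2)"
    using q m by (intro divide_left_mono power_mono mult_pos_pos zero_less_power) auto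
  ultimately have x: "1 / (real_of_int m + 2) ^ (n + 2) \<le> x" by linarith
  \<comment> \<open>The choice of \<open>t\<close> turns powers of \<open>m + 2\<close>, which bound
    the separation of values, into powers of \<open>m\<close>, which measure the parameters.\<close>
  have "1 / real_of_int m ^ (n + 2) \<le> 1 / ((real_of_int m + 2) powr t) ^ (n + 2)"
    using m by (intro divide_left_mono power_mono mult_pos_pos zero_less_power) auto
  also have "\<dots> = (1 / (real_of_int m + 2) ^ (n + 2)) powr t"
  proof -
    define B where "B = real_of_int m + 2"
    have B: "B > 0" using m by (simp add: B_def)
    have "(B powr t) ^ (n + 2) = (B powr t) powr real (n + 2)"
      using B by (intro powr_realpow[symmetric]) simp
    also have "\<dots> = (B powr real (n + 2)) powr t" by (simp only: powr_powr mult.commute)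
    also have "\<dots> = (B ^ (n + 2)) powr t" using B by (simp only: powr_realpow)
    finally show ?thesis unfolding B_def[symmetric] using B by (simp add: powr_divide)
  qed
  also have "\<dots> \<le> x powr t" using x m t by (intro powr_mono2) auto
  finally have xt: "1 / real_of_int m ^ (n + 2) \<le> x powr t" .
  have "real_of_int m ^ n * \<bar>y - y'\<bar> \<le> 1" using floor_eq[OF fl[of n]] by simp
  then have "\<bar>y - y'\<bar> \<le> 1 / real_of_int m ^ n" using m by (simp add: field_simps)
  \<comment> \<open>The factor \<open>m^2\<close> absorbs the two extra powers in the separation
    bound.\<close>
  also have "\<dots> = real_of_int (m\<^sup>2) * (1 / real_of_int m ^ (n + 2))"
    using m(1) by (simp add: power_add power2_eq_square)
  also have "\<dots> \<le> real_of_int (m\<^sup>2) * x powr t" using xt by (intro mult_left_mono) auto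
  finally show ?thesis unfolding x_def .
qed simp

section \<open>Area of parameter sets and the mass distribution argument\<close>

lemma borel_measurable_shifted_digit_value:
  "(\<lambda>p. base_value (snd p) (shifted_digit m (fst p))) \<in> borel_measurable (lborel \<Otimes>\<^sub>M lborel)"
proof -
  have "(\<lambda>p :: real \<times> real. \<Sum>n. (1 + real_of_int \<lfloor>real_of_int m ^ Suc n * fst p\<rfloor>
      - real_of_int m * real_of_int \<lfloor>real_of_int m ^ n * fst p\<rfloor>) / snd p ^ Suc n)
    \<in> borel_measurable (lborel \<Otimes>\<^sub>M lborel)"
    by measurable
  then show ?thesis unfolding base_value_def shifted_digit_def by simp
qed

text \<open>\<open>G C\<close> is the preimage of \<open>C\<close> in the parameters
  \<open>(y, q)\<close>. For fixed \<open>q\<close> the Hoelder estimate confines \<open>y\<close>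
  to length \<open>2 * K * d powr t\<close>, and \<open>q\<close> itself varies in an interval of
  length \<open>2 * d\<close>.\<close>

lemma emeasure_parameters_le:
  fixes m :: int and t :: real
  defines "G \<equiv> \<lambda>C. {p. 0 \<le> fst p \<and> fst p < 1 \<and> real_of_int m + 1 < snd p \<and> snd p \<le> real_of_int m + 2
    \<and> (base_value (snd p) (shifted_digit m (fst p)), snd p) \<in> C}"
  assumes m: "m \<ge> 2" "(real_of_int m + 2) powr t \<le> real_of_int m" and t: "t > 0"
    and C: "closed C" "bounded C"
  shows "G C \<in> sets (lborel \<Otimes>\<^sub>M lborel)"
    and "emeasure (lborel \<Otimes>\<^sub>M lborel) (G C) \<le> ennreal (4 * real_of_int (m\<^sup>2) * diameter C powr (1 + t))"
proof -
  define d where "d = diameter C"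
  define K where "K = real_of_int (m\<^sup>2)"
  have d: "d \<ge> 0" unfolding d_def using C by (intro diameter_ge_0)
  have K: "K \<ge> 0" by (simp add: K_def)
  note [measurable] = borel_measurable_shifted_digit_value
  have [measurable]: "C \<in> sets borel" using C by auto
  have "(\<lambda>p. (base_value (snd p) (shifted_digit m (fst p)), snd p)) \<in> (lborel \<Otimes>\<^sub>M lborel) \<rightarrow>\<^sub>M borel"
    by measurable
  then have [measurable]: "Measurable.pred (lborel \<Otimes>\<^sub>M lborel)
      (\<lambda>p. (base_value (snd p) (shifted_digit m (fst p)), snd p) \<in> C)"
    by (rule pred_sets2[rotated]) measurable
  have "{p \<in> space (lborel \<Otimes>\<^sub>M lborel). 0 \<le> fst p \<and> fst p < 1 \<and> real_of_int m + 1 < snd p \<and> snd p \<le> real_of_int m + 2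
    \<and> (base_value (snd p) (shifted_digit m (fst p)), snd p) \<in> C} \<in> sets (lborel \<Otimes>\<^sub>M lborel)"
    by measurable
  then show G: "G C \<in> sets (lborel \<Otimes>\<^sub>M lborel)" unfolding G_def by (simp add: space_pair_measure)
  have slice: "emeasure lborel ((\<lambda>y. (y, q)) -` G C) \<le> ennreal (2 * (K * d powr t))" for q
  proof (cases "(\<lambda>y. (y, q)) -` G C = {}")
    case False
    then obtain y0 where y0: "(y0, q) \<in> G C" by auto
    have "\<bar>y - y0\<bar> \<le> K * d powr t" if y: "(y, q) \<in> G C" for y
    proof -
      let ?x = "\<bar>base_value q (shifted_digit m y) - base_value q (shifted_digit m y0)\<bar>"
      have "dist (base_value q (shifted_digit m y), q) (base_value q (shifted_digit m y0), q) \<le> d"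
        unfolding d_def using y y0 C by (intro diameter_bounded_bound) (auto simp: G_def)
      then have "?x \<le> d" by (simp add: dist_Pair_Pair dist_real_def)
      then have "?x powr t \<le> d powr t" using t by (intro powr_mono2) auto
      moreover have "\<bar>y - y0\<bar> \<le> K * ?x powr t" unfolding K_def
        by (rule shifted_digit_holder[OF m t]) (use y y0 in \<open>auto simp: G_def\<close>)
      ultimately show ?thesis using K mult_left_mono[of "?x powr t" "d powr t" K] by linarith
    qed
    then have "(\<lambda>y. (y, q)) -` G C \<subseteq> {y0 - K * d powr t..y0 + K * d powr t}" by (force simp: abs_le_iff)
    then have "emeasure lborel ((\<lambda>y. (y, q)) -` G C) \<le> emeasure lborel {y0 - K * d powr t..y0 + K * d powr t}"
      by (intro emeasure_mono) auto
    also have "\<dots> = ennreal (2 * (K * d powr t))" using K by simp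
    finally show ?thesis .
  qed simp
  show "emeasure (lborel \<Otimes>\<^sub>M lborel) (G C) \<le> ennreal (4 * real_of_int (m\<^sup>2) * diameter C powr (1 + t))"
  proof (cases "G C = {}")
    case False
    then obtain y0 q0 where q0: "(y0, q0) \<in> G C" by auto
    have near: "q \<in> {q0 - d..q0 + d}" if "(y, q) \<in> G C" for y q
    proof -
      have "dist (base_value q (shifted_digit m y), q) (base_value q0 (shifted_digit m y0), q0) \<le> d"
        unfolding d_def using that q0 C by (intro diameter_bounded_bound) (auto simp: G_def)
      moreover have "\<bar>q - q0\<bar> \<le> dist (base_value q (shifted_digit m y), q) (base_value q0 (shifted_digit m y0), q0)"
        using dist_snd_le[of "(base_value q (shifted_digit m y), q)" "(base_value q0 (shifted_digit m y0), q0)"]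
        by (simp add: dist_real_def)
      ultimately show ?thesis by auto
    qed
    have "emeasure (lborel \<Otimes>\<^sub>M lborel) (G C) = (\<integral>\<^sup>+q. emeasure lborel ((\<lambda>y. (y, q)) -` G C) \<partial>lborel)"
      by (rule lborel_pair.emeasure_pair_measure_alt2[OF G])
    also have "\<dots> \<le> (\<integral>\<^sup>+q. ennreal (2 * (K * d powr t)) * indicator {q0 - d..q0 + d} q \<partial>lborel)"
    proof (rule nn_integral_mono)
      fix q :: real
      show "emeasure lborel ((\<lambda>y. (y, q)) -` G C) \<le> ennreal (2 * (K * d powr t)) * indicator {q0 - d..q0 + d} q"
      proof (cases "q \<in> {q0 - d..q0 + d}")
        case True
        then show ?thesis using slice[of q] by simp
      next
        case False
        then have "(\<lambda>y. (y, q)) -` G C = {}" using near by blast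
        then show ?thesis by simp
      qed
    qed
    also have "\<dots> = ennreal (2 * (K * d powr t)) * ennreal (2 * d)"
      using d by (subst nn_integral_cmult_indicator) auto
    also have "\<dots> = ennreal (2 * (K * d powr t) * (2 * d))"
      using K d by (intro ennreal_mult[symmetric]) auto
    also have "2 * (K * d powr t) * (2 * d) = 4 * K * d powr (1 + t)" using d
      by (cases "d = 0") (auto simp: powr_add)
    finally show ?thesis unfolding K_def d_def .
  qed simp
qed

text \<open>As \<open>m + 2 \<le> 2 * m\<close>, the left side is at most
  \<open>2 * m powr t\<close>, so \<open>m powr (1 - t) \<ge> 2\<close> suffices; this dictates the
  witness.\<close>

lemma large_alphabet_exists:
  fixes t :: real
  assumes "t < 1" "t > 0"
  shows "\<exists>m::int. m \<ge> 2 \<and> (real_of_int m + 2) powr t \<le> real_of_int m"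
proof -
  define m where "m = max 2 \<lceil>2 powr (1 / (1 - t))\<rceil>"
  have m: "m \<ge> 2" "2 powr (1 / (1 - t)) \<le> real_of_int m" unfolding m_def by linarith+
  have "2 powr 1 = (2 powr (1 / (1 - t))) powr (1 - t)" using assms by (simp add: powr_powr)
  also have "\<dots> \<le> real_of_int m powr (1 - t)" using m assms by (intro powr_mono2) auto
  finally have 2: "2 \<le> real_of_int m powr (1 - t)" by simp
  have "(real_of_int m + 2) powr t \<le> (2 * real_of_int m) powr t" using m assms by (intro powr_mono2) auto
  also have "\<dots> = 2 powr t * real_of_int m powr t" using m by (simp add: powr_mult)
  also have "\<dots> \<le> 2 powr 1 * real_of_int m powr t" using assms by (intro mult_right_mono powr_mono) auto
  also have "\<dots> \<le> real_of_int m powr (1 - t) * real_of_int m powr t" using 2 by (intro mult_right_mono) auto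
  also have "\<dots> = real_of_int m" using m by (simp add: powr_add[symmetric])
  finally show ?thesis using m(1) by blast
qed

text \<open>A cover of the univoque set pulls back to a cover of the parameter square
  \<open>Q\<close> of area 1. Each set accounts for area at most \<open>K\<close> times its cost, so
  the total cost is at least \<open>1 / K\<close>.\<close>

lemma hausdorff_measure_univoque_pos:
  assumes s: "0 \<le> s" "s < 2"
  shows "hausdorff_measure s univoque_set \<noteq> 0"
proof
  assume "hausdorff_measure s univoque_set = 0"
  then have "hausdorff_approx s 1 univoque_set \<le> 0"
    unfolding hausdorff_measure_def by (metis SUP_upper greaterThan_iff zero_less_one)
  \<comment> \<open>The bound \<open>s - 1\<close> gives \<open>s \<le> 1 + t\<close>; the bound 1/2
    keeps \<open>t\<close> positive when \<open>s\<close> is small.\<close>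
  define t where "t = max (1 / 2) (s - 1)"
  have t: "0 < t" "t < 1" "s \<le> 1 + t" using s unfolding t_def by auto
  obtain m :: int where m: "m \<ge> 2" "(real_of_int m + 2) powr t \<le> real_of_int m"
    using large_alphabet_exists[OF t(2,1)] by blast
  define K where "K = 4 * real_of_int (m\<^sup>2)"
  have K: "K > 0" using m by (simp add: K_def)
  \<comment> \<open>A cover cheaper than \<open>1 / (2 * K)\<close> would bound the area of
    \<open>Q\<close> by 1/2.\<close>
  have "hausdorff_approx s 1 univoque_set < ennreal (1 / (2 * K))"
    using \<open>hausdorff_approx s 1 univoque_set \<le> 0\<close> K by (simp add: ennreal_zero_less_divide)
  then obtain C :: "nat \<Rightarrow> (real \<times> real) set" where C: "univoque_set \<subseteq> \<Union>(range C)"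
      "\<And>n. bounded (C n)" "\<And>n. diameter (C n) \<le> 1" "(\<Sum>n. hdiam_pow s (C n)) < ennreal (1 / (2 * K))"
    unfolding hausdorff_approx_def INF_less_iff by auto
  define G where "G C = {p. 0 \<le> fst p \<and> fst p < 1 \<and> real_of_int m + 1 < snd p \<and> snd p \<le> real_of_int m + 2
    \<and> (base_value (snd p) (shifted_digit m (fst p)), snd p) \<in> C}" for C
  \<comment> \<open>Covering sets are arbitrary; closing them makes the preimages measurable without
    changing the diameter.\<close>
  have G: "G (closure (C n)) \<in> sets (lborel \<Otimes>\<^sub>M lborel)"
    "emeasure (lborel \<Otimes>\<^sub>M lborel) (G (closure (C n))) \<le> ennreal (K * diameter (C n) powr (1 + t))" for n
    using emeasure_parameters_le[OF m t(1), of "closure (C n)"] C(2)[of n]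
    unfolding G_def K_def by (auto simp: diameter_closure)
  have le: "emeasure (lborel \<Otimes>\<^sub>M lborel) (G (closure (C n))) \<le> ennreal K * hdiam_pow s (C n)" for n
  proof (cases "C n = {}")
    case True
    then show ?thesis by (simp add: G_def)
  next
    case False
    have d: "0 \<le> diameter (C n)" "diameter (C n) \<le> 1" using C diameter_ge_0 by auto
    \<comment> \<open>The exponent can be lowered to \<open>s\<close> because diameters are at most
      1; \<open>s = 0\<close> follows the convention of \<open>hdiam_pow\<close> that nonempty sets
      cost 1.\<close>
    have "diameter (C n) powr (1 + t) \<le> (if s = 0 then 1 else diameter (C n) powr s)"
    proof (cases "diameter (C n) = 0 \<or> s = 0")
      case True
      then show ?thesis using d t by (auto intro: powr_le1)
    next
      case False
      then show ?thesis using d t by (auto intro!: powr_mono')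
    qed
    then have "ennreal (K * diameter (C n) powr (1 + t)) \<le> ennreal (K * (if s = 0 then 1 else diameter (C n) powr s))"
      using K by (intro ennreal_leI mult_left_mono) auto
    also have "\<dots> = ennreal K * hdiam_pow s (C n)"
      using K False by (simp add: hdiam_pow_def ennreal_mult)
    finally show ?thesis using G(2)[of n] by (rule order_trans[rotated])
  qed
  define Q where "Q = {0..<1::real} \<times> {real_of_int m + 1<..real_of_int m + 2}"
  have "Q \<subseteq> (\<Union>n. G (closure (C n)))"
  proof
    fix p assume p: "p \<in> Q"
    then have q: "real_of_int m + 1 < snd p" "snd p \<le> real_of_int m + 2" by (auto simp: Q_def)
    \<comment> \<open>The largest digit in these bases is \<open>m + 1\<close>, so the digits from 1
      to \<open>m\<close> are inner digits.\<close>
    then have "\<lceil>snd p\<rceil> = m + 2" by (intro ceiling_unique) auto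
    then have "(base_value (snd p) (shifted_digit m (fst p)), snd p) \<in> univoque_set"
      using q m shifted_digit_bounds[of m] by (intro univoque_if_inner_digits) auto
    then obtain n where "(base_value (snd p) (shifted_digit m (fst p)), snd p) \<in> C n" using C(1) by blast
    then have "p \<in> G (closure (C n))" using p closure_subset[of "C n"] by (auto simp: G_def Q_def)
    then show "p \<in> (\<Union>n. G (closure (C n)))" by blast
  qed
  have "emeasure (lborel \<Otimes>\<^sub>M lborel) Q = emeasure lborel {0..<1::real} * emeasure lborel {real_of_int m + 1<..real_of_int m + 2}"
    unfolding Q_def by (intro lborel.emeasure_pair_measure_Times) auto
  also have "\<dots> = 1" by simp
  finally have "1 = emeasure (lborel \<Otimes>\<^sub>M lborel) Q" by simp
  also have "\<dots> \<le> emeasure (lborel \<Otimes>\<^sub>M lborel) (\<Union>n. G (closure (C n)))"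
    using \<open>Q \<subseteq> _\<close> G(1) by (intro emeasure_mono) auto
  also have "\<dots> \<le> (\<Sum>n. emeasure (lborel \<Otimes>\<^sub>M lborel) (G (closure (C n))))"
    using G(1) by (intro emeasure_subadditive_countably) auto
  also have "\<dots> \<le> (\<Sum>n. ennreal K * hdiam_pow s (C n))" by (intro suminf_le le) auto
  also have "\<dots> = ennreal K * (\<Sum>n. hdiam_pow s (C n))" by (rule ennreal_suminf_cmult)
  also have "\<dots> \<le> ennreal K * ennreal (1 / (2 * K))" using C(4) by (intro mult_left_mono) auto
  also have "\<dots> = ennreal (K * (1 / (2 * K)))" by (rule ennreal_mult[symmetric]) (use K in auto)
  also have "K * (1 / (2 * K)) = 1 / 2" using K by simp
  finally have "ennreal 1 \<le> ennreal (1 / 2)" by simp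
  then show False by (subst (asm) ennreal_le_iff) auto
qed

theorem theorem1p1:
  shows "\<not> closed univoque_set
    \<and> closure univoque_set \<noteq> {} \<and> closed (closure univoque_set)
    \<and> interior (closure univoque_set) = {}
    \<and> (\<forall>p \<in> closure univoque_set. p islimpt closure univoque_set)
    \<and> univoque_set \<in> null_sets lebesgue
    \<and> closure univoque_set \<in> null_sets lebesgue
    \<and> hausdorff_dim univoque_set = 2
    \<and> hausdorff_dim (closure univoque_set) = 2"
proof (intro conjI)
  show "\<not> closed univoque_set" by (rule univoque_not_closed)
  then show "closure univoque_set \<noteq> {}" by auto
  show "closed (closure univoque_set)" by simp
  show null: "closure univoque_set \<in> null_sets lebesgue"
    using closure_univoque_null by (rule null_sets_completionI)
  then show "univoque_set \<in> null_sets lebesgue"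
    by (rule null_sets_completion_subset[OF closure_subset])
  have "negligible (interior (closure univoque_set))"
    using null negligible_iff_null_sets negligible_subset interior_subset by blast
  then show "interior (closure univoque_set) = {}"
    using open_not_negligible open_interior by blast
  show "\<forall>p \<in> closure univoque_set. p islimpt closure univoque_set"
  proof
    fix p assume "p \<in> closure univoque_set"
    then have "p islimpt univoque_set" using univoque_islimpt unfolding closure_def by (cases p) auto
    then show "p islimpt closure univoque_set" by (rule islimpt_subset[OF _ closure_subset])
  qed
  show "hausdorff_dim univoque_set = 2"
    by (rule hausdorff_dim_plane_eq_2) (rule hausdorff_measure_univoque_pos)
  show "hausdorff_dim (closure univoque_set) = 2"
  proof (rule hausdorff_dim_plane_eq_2)
    fix s :: real assume "0 \<le> s" "s < 2"
    then show "hausdorff_measure s (closure univoque_set) \<noteq> 0"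
      using hausdorff_measure_univoque_pos hausdorff_measure_mono[OF closure_subset, of s univoque_set]
      by auto
  qed
qed

end
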